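(* Let $g\ge 2$ be an integer and let $G$ be an extra-special group of order $2^{2g+1}$. Then $G$ is an admissible quotient of $\mathsf{B}_2(\Sigma_g)$ if and only if $g$ is odd. In this case, the number $N_g(G)$ of admissible epimorphisms $\varphi\colon\mathsf{B}_2(\Sigma_g)\to G$ is given by $$N_g(G)=2^{2g+1}A(G)\cdot|\mathsf{Sp}(2g,\mathbb{F}_2)|,$$ where $\mathsf{Sp}(2g,\mathbb{F}_2)$ is the symplectic group of $2g\times 2g$ matrices over the field $\mathbb{F}_2$ and $$A(G)=\begin{cases}2^{2g-1}-2^{g-1}&\text{if } G=\mathsf{H}_{2g+1}(\mathbb{F}_2),\\ 2^{2g-1}+2^{g-1}&\text{if } G=\mathsf{G}_{2g+1}(\mathbb{F}_2).\end{cases}$$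
   Context: Commutators are $[x,y]=xyx^{-1}y^{-1}$. Let $\Sigma_g$ be a compact Riemann surface of genus $g$. The full braid group on two strings $\mathsf{B}_2(\Sigma_g)\simeq\pi_1(\operatorname{Sym}^2\Sigma_g-\delta)$ (with $\delta$ the diagonal) is the group generated by $a_1,b_1,\dots,a_g,b_g,\sigma$ subject to the relations: $[a_i,\sigma^{-1}a_i\sigma^{-1}]=1$ and $[b_i,\sigma^{-1}b_i\sigma^{-1}]=1$ for $1\le i\le g$; $[a_i,\sigma^{-1}a_j\sigma]=[a_i,\sigma^{-1}b_j\sigma]=[b_i,\sigma^{-1}a_j\sigma]=[b_i,\sigma^{-1}b_j\sigma]=1$ for $j<i$; $[a_i,\sigma^{-1}b_i\sigma^{-1}]=\sigma^2$ for $1\le i\le g$; and $[a_1,b_1^{-1}]\cdots[a_g,b_g^{-1}]=\sigma^2$. For a finite group $G$, a group epimorphism $\varphi\colon\mathsf{B}_2(\Sigma_g)\to G$ is called admissible if $\varphi(\sigma)$ has order $n\ge 2$ (i.e. $\varphi(\sigma)\neq 1$); $G$ is called an admissible quotient of $\mathsf{B}_2(\Sigma_g)$ if such a $\varphi$ exists. $N_g(G)$ denotes the total number of admissible epimorphisms $\mathsf{B}_2(\Sigma_g)\to G$. A finite $p$-group $G$ is extra-special if its center $Z(G)$ is cyclic of order $p$ and $G/Z(G)$ is a nontrivial elementary abelian $p$-group. It is classical that for $g\ge2$ there are exactly two isomorphism classes of extra-special groups of order $p^{2g+1}$, represented (here for $p=2$) by the groups generated by $x_1,y_1,\dots,x_g,y_g,z$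 with the following relations, for all $i,j$. Common relations: $z^2=1$, $[x_i,z]=[y_i,z]=1$, $[x_i,x_j]=[y_i,y_j]=1$, $[x_i,y_j]=z^{-\delta_{ij}}$ ($\delta_{ij}$ the Kronecker symbol). In $\mathsf{H}_{2g+1}(\mathbb{F}_2)$ one adds $x_i^2=y_i^2=1$ for all $i=1,\dots,g$; in $\mathsf{G}_{2g+1}(\mathbb{F}_2)$ one adds $x_i^2=y_i^2=1$ for $i=1,\dots,g-1$ and $x_g^2=y_g^2=z$. *)

theory Defs
  imports
    "HOL-Algebra.Elementary_Groups"
    "HOL-Algebra.Multiplicative_Group"
    "HOL-Library.Z2"
    "Jordan_Normal_Form.Matrix"
begin

section \<open>Groups given by generators and relations\<close>

text \<open>A word is a list of signed letters: \<^term>\<open>(x, True)\<close> stands for \<open>x\<close> and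
  \<^term>\<open>(x, False)\<close> for its formal inverse.\<close>

type_synonym 'x word = "('x \<times> bool) list"

definition words :: "'x set \<Rightarrow> 'x word set" where
  "words X = lists (X \<times> UNIV)"

definition letter :: "'x \<Rightarrow> 'x word" where
  "letter x = [(x, True)]"

definition winv :: "'x word \<Rightarrow> 'x word" where
  "winv w = rev (map (\<lambda>(x, s). (x, \<not> s)) w)"

definition wcomm :: "'x word \<Rightarrow> 'x word \<Rightarrow> 'x word" where
  "wcomm u v = u @ v @ winv u @ winv v"

text \<open>The least congruence on the words over \<open>X\<close> that contains the free cancellations and
  all relations \<open>u = v\<close> with \<open>(u, v) \<in> R\<close>. The quotient is the free group on \<open>X\<close> modulo the
  normal closure of the relators \<open>u v\<inverse>\<close>.\<close>

inductive pres_cong :: "'x set \<Rightarrow> ('x word \<times> 'x word) set \<Rightarrow> 'x word \<Rightarrow> 'x word \<Rightarrow> bool"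
  for X R where
  refl: "w \<in> words X \<Longrightarrow> pres_cong X R w w"
| sym: "pres_cong X R u v \<Longrightarrow> pres_cong X R v u"
| trans: "pres_cong X R u v \<Longrightarrow> pres_cong X R v w \<Longrightarrow> pres_cong X R u w"
| append: "pres_cong X R u u' \<Longrightarrow> pres_cong X R v v' \<Longrightarrow> pres_cong X R (u @ v) (u' @ v')"
| cancel: "x \<in> X \<Longrightarrow> pres_cong X R [(x, s), (x, \<not> s)] []"
| rel: "(u, v) \<in> R \<Longrightarrow> u \<in> words X \<Longrightarrow> v \<in> words X \<Longrightarrow> pres_cong X R u v"

definition pres_class :: "'x set \<Rightarrow> ('x word \<times> 'x word) set \<Rightarrow> 'x word \<Rightarrow> 'x word set" where
  "pres_class X R w = {v. pres_cong X R w v}"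

definition presented_group ::
    "'x set \<Rightarrow> ('x word \<times> 'x word) set \<Rightarrow> 'x word set monoid" where
  "presented_group X R =
     \<lparr> carrier = pres_class X R ` words X,
       monoid.mult = (\<lambda>A B. \<Union>u\<in>A. \<Union>v\<in>B. pres_class X R (u @ v)),
       one = pres_class X R [] \<rparr>"

lemma words_simps [simp]:
  "[] \<in> words X"
  "a # w \<in> words X \<longleftrightarrow> fst a \<in> X \<and> w \<in> words X"
  "u @ v \<in> words X \<longleftrightarrow> u \<in> words X \<and> v \<in> words X"
  "winv w \<in> words X \<longleftrightarrow> w \<in> words X"
  by (cases a, auto simp: words_def winv_def in_lists_conv_set mem_Times_iff split: prod.splits)

lemma pres_cong_words: "pres_cong X R u v \<Longrightarrow> u \<in> words X \<and> v \<in> words X"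
  by (induction rule: pres_cong.induct) auto

lemma pres_class_eq_iff:
  assumes "u \<in> words X"
  shows "pres_class X R u = pres_class X R v \<longleftrightarrow> pres_cong X R u v"
  unfolding pres_class_def set_eq_iff mem_Collect_eq
  using pres_cong.refl[OF assms] pres_cong.sym pres_cong.trans by metis

lemma presented_group_mult:
  assumes "u \<in> words X" "v \<in> words X"
  shows "pres_class X R u \<otimes>\<^bsub>presented_group X R\<^esub> pres_class X R v = pres_class X R (u @ v)"
proof -
  have "pres_class X R (u' @ v') = pres_class X R (u @ v)"
    if "u' \<in> pres_class X R u" "v' \<in> pres_class X R v" for u' v'
    using that assms
    by (metis mem_Collect_eq pres_class_def pres_class_eq_iff pres_cong.append words_simps(3))
  moreover have "u \<in> pres_class X R u" "v \<in> pres_class X R v"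
    using assms pres_cong.refl by (auto simp: pres_class_def)
  ultimately show ?thesis
    unfolding presented_group_def monoid.simps by blast
qed

lemma pres_cong_winv: "w \<in> words X \<Longrightarrow> pres_cong X R (winv w @ w) []"
proof (induction w)
  case Nil
  then show ?case by (auto simp: winv_def intro: pres_cong.refl)
next
  case (Cons a w)
  obtain x s where a: "a = (x, s)" by (cases a)
  have w: "w \<in> words X" "x \<in> X" using Cons.prems a by auto
  have "pres_cong X R [(x, \<not> s), (x, s)] []"
    using pres_cong.cancel[of x X R "\<not> s"] w by simp
  then have "pres_cong X R ([(x, \<not> s), (x, s)] @ w) ([] @ w)"
    by (rule pres_cong.append[OF _ pres_cong.refl[OF w(1)]])
  then have "pres_cong X R (winv w @ [(x, \<not> s), (x, s)] @ w) (winv w @ [] @ w)"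
    by (intro pres_cong.append[OF pres_cong.refl]) (simp_all add: w)
  then have "pres_cong X R (winv w @ [(x, \<not> s), (x, s)] @ w) (winv w @ w)"
    by simp
  then have "pres_cong X R (winv w @ [(x, \<not> s), (x, s)] @ w) []"
    using Cons.IH w pres_cong.trans by blast
  then show ?case by (simp add: a winv_def)
qed

lemma group_presented_group: "group (presented_group X R)"
proof (rule groupI)
  fix A assume "A \<in> carrier (presented_group X R)"
  then obtain u where u: "u \<in> words X" "A = pres_class X R u"
    by (auto simp: presented_group_def)
  have one: "\<one>\<^bsub>presented_group X R\<^esub> = pres_class X R []" by (simp add: presented_group_def)
  show "\<one>\<^bsub>presented_group X R\<^esub> \<otimes>\<^bsub>presented_group X R\<^esub> A = A"
    using u by (simp add: one presented_group_mult)
  have "pres_class X R (winv u) \<otimes>\<^bsub>presented_group X R\<^esub> A = \<one>\<^bsub>presented_group X R\<^esub>"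
    using u by (simp add: one presented_group_mult pres_class_eq_iff pres_cong_winv)
  moreover have "pres_class X R (winv u) \<in> carrier (presented_group X R)"
    using u by (auto simp: presented_group_def)
  ultimately show "\<exists>B\<in>carrier (presented_group X R).
      B \<otimes>\<^bsub>presented_group X R\<^esub> A = \<one>\<^bsub>presented_group X R\<^esub>"
    by blast
next
  show "\<one>\<^bsub>presented_group X R\<^esub> \<in> carrier (presented_group X R)"
    by (auto simp: presented_group_def)
next
  fix A B assume "A \<in> carrier (presented_group X R)" "B \<in> carrier (presented_group X R)"
  then obtain u v where uv: "u \<in> words X" "A = pres_class X R u"
      "v \<in> words X" "B = pres_class X R v"
    by (auto simp: presented_group_def)
  then have "A \<otimes>\<^bsub>presented_group X R\<^esub> B = pres_class X R (u @ v)"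
    by (simp add: presented_group_mult)
  with uv show "A \<otimes>\<^bsub>presented_group X R\<^esub> B \<in> carrier (presented_group X R)"
    by (auto simp: presented_group_def)
next
  fix A B C
  assume "A \<in> carrier (presented_group X R)" "B \<in> carrier (presented_group X R)"
    "C \<in> carrier (presented_group X R)"
  then obtain u v w where "u \<in> words X" "A = pres_class X R u"
      "v \<in> words X" "B = pres_class X R v" "w \<in> words X" "C = pres_class X R w"
    by (auto simp: presented_group_def)
  then show "A \<otimes>\<^bsub>presented_group X R\<^esub> B \<otimes>\<^bsub>presented_group X R\<^esub> C =
      A \<otimes>\<^bsub>presented_group X R\<^esub> (B \<otimes>\<^bsub>presented_group X R\<^esub> C)"
    by (simp add: presented_group_mult)
qed


section \<open>The braid group on two strings of a surface of genus \<open>g\<close>\<close>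

datatype braid_gen = BA nat | BB nat | BSigma

definition braid_gens :: "nat \<Rightarrow> braid_gen set" where
  "braid_gens g = BA ` {1..g} \<union> BB ` {1..g} \<union> {BSigma}"

definition braid_rels :: "nat \<Rightarrow> (braid_gen word \<times> braid_gen word) set" where
  "braid_rels g =
    (let a = (\<lambda>i. letter (BA i)); b = (\<lambda>i. letter (BB i)); \<sigma> = letter BSigma in
      {(wcomm (a i) (winv \<sigma> @ a i @ winv \<sigma>), []) | i. i \<in> {1..g}}
    \<union> {(wcomm (b i) (winv \<sigma> @ b i @ winv \<sigma>), []) | i. i \<in> {1..g}}
    \<union> {(wcomm (a i) (winv \<sigma> @ a j @ \<sigma>), []) | i j. i \<in> {1..g} \<and> j \<in> {1..g} \<and> j < i}
    \<union> {(wcomm (a i) (winv \<sigma> @ b j @ \<sigma>), []) | i j. i \<in> {1..g} \<and> j \<in> {1..g} \<and> j < i}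
    \<union> {(wcomm (b i) (winv \<sigma> @ a j @ \<sigma>), []) | i j. i \<in> {1..g} \<and> j \<in> {1..g} \<and> j < i}
    \<union> {(wcomm (b i) (winv \<sigma> @ b j @ \<sigma>), []) | i j. i \<in> {1..g} \<and> j \<in> {1..g} \<and> j < i}
    \<union> {(wcomm (a i) (winv \<sigma> @ b i @ winv \<sigma>), \<sigma> @ \<sigma>) | i. i \<in> {1..g}}
    \<union> {(concat (map (\<lambda>i. wcomm (a i) (winv (b i))) [1..<Suc g]), \<sigma> @ \<sigma>)})"

definition B2 :: "nat \<Rightarrow> braid_gen word set monoid" where
  "B2 g = presented_group (braid_gens g) (braid_rels g)"

definition braid_sigma :: "nat \<Rightarrow> braid_gen word set" where
  "braid_sigma g = pres_class (braid_gens g) (braid_rels g) (letter BSigma)"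

definition admissible :: "nat \<Rightarrow> ('a, 'b) monoid_scheme \<Rightarrow> (braid_gen word set \<Rightarrow> 'a) \<Rightarrow> bool" where
  "admissible g G \<phi> \<longleftrightarrow> \<phi> \<in> epi (B2 g) G \<and> group.ord G (\<phi> (braid_sigma g)) \<ge> 2"

definition admissible_quotient :: "nat \<Rightarrow> ('a, 'b) monoid_scheme \<Rightarrow> bool" where
  "admissible_quotient g G \<longleftrightarrow> (\<exists>\<phi>. admissible g G \<phi>)"

text \<open>Restricting to \<^const>\<open>extensional\<close> functions makes each homomorphism count once,
  since members of \<^const>\<open>epi\<close> are otherwise arbitrary outside the carrier.\<close>

definition num_admissible :: "nat \<Rightarrow> ('a, 'b) monoid_scheme \<Rightarrow> nat" where
  "num_admissible g G = card {\<phi> \<in> extensional (carrier (B2 g)). admissible g G \<phi>}"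


section \<open>Extra-special groups\<close>

definition group_center :: "('a, 'b) monoid_scheme \<Rightarrow> 'a set" where
  "group_center G = {z \<in> carrier G. \<forall>x\<in>carrier G. z \<otimes>\<^bsub>G\<^esub> x = x \<otimes>\<^bsub>G\<^esub> z}"

definition elementary_abelian :: "nat \<Rightarrow> ('a, 'b) monoid_scheme \<Rightarrow> bool" where
  "elementary_abelian p G \<longleftrightarrow>
     comm_group G \<and> (\<forall>x\<in>carrier G. x [^]\<^bsub>G\<^esub> p = \<one>\<^bsub>G\<^esub>)"

definition extra_special :: "nat \<Rightarrow> ('a, 'b) monoid_scheme \<Rightarrow> bool" where
  "extra_special p G \<longleftrightarrow>
     Factorial_Ring.prime p \<and> group G \<and> finite (carrier G) \<and> (\<exists>k. order G = p ^ k) \<and>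
     cyclic_group (G\<lparr>carrier := group_center G\<rparr>) \<and> card (group_center G) = p \<and>
     elementary_abelian p (G Mod group_center G) \<and> \<not> trivial_group (G Mod group_center G)"

datatype es_gen = ESX nat | ESY nat | ESZ

definition es_gens :: "nat \<Rightarrow> es_gen set" where
  "es_gens g = ESX ` {1..g} \<union> ESY ` {1..g} \<union> {ESZ}"

definition es_common_rels :: "nat \<Rightarrow> (es_gen word \<times> es_gen word) set" where
  "es_common_rels g =
    (let x = (\<lambda>i. letter (ESX i)); y = (\<lambda>i. letter (ESY i)); z = letter ESZ in
      {(z @ z, [])}
    \<union> {(wcomm (x i) z, []) | i. i \<in> {1..g}}
    \<union> {(wcomm (y i) z, []) | i. i \<in> {1..g}}
    \<union> {(wcomm (x i) (x j), []) | i j. i \<in> {1..g} \<and> j \<in> {1..g}}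
    \<union> {(wcomm (y i) (y j), []) | i j. i \<in> {1..g} \<and> j \<in> {1..g}}
    \<union> {(wcomm (x i) (y j), if i = j then winv z else []) | i j. i \<in> {1..g} \<and> j \<in> {1..g}})"

definition H_rels :: "nat \<Rightarrow> (es_gen word \<times> es_gen word) set" where
  "H_rels g = es_common_rels g
    \<union> {(letter (ESX i) @ letter (ESX i), []) | i. i \<in> {1..g}}
    \<union> {(letter (ESY i) @ letter (ESY i), []) | i. i \<in> {1..g}}"

definition G_rels :: "nat \<Rightarrow> (es_gen word \<times> es_gen word) set" where
  "G_rels g = es_common_rels g
    \<union> {(letter (ESX i) @ letter (ESX i), []) | i. i \<in> {1..<g}}
    \<union> {(letter (ESY i) @ letter (ESY i), []) | i. i \<in> {1..<g}}
    \<union> {(letter (ESX g) @ letter (ESX g), letter ESZ), (letter (ESY g) @ letter (ESY g), letter ESZ)}"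

text \<open>The parameter is \<open>g\<close>, not \<open>2g + 1\<close>: these are \<open>H\<^bsub>2g+1\<^esub>(F\<^sub>2)\<close> and \<open>G\<^bsub>2g+1\<^esub>(F\<^sub>2)\<close>.\<close>

definition H_group :: "nat \<Rightarrow> es_gen word set monoid" where
  "H_group g = presented_group (es_gens g) (H_rels g)"

definition G_group :: "nat \<Rightarrow> es_gen word set monoid" where
  "G_group g = presented_group (es_gens g) (G_rels g)"

text \<open>The equalities \<open>G = H\<^bsub>2g+1\<^esub>(F\<^sub>2)\<close> and \<open>G = G\<^bsub>2g+1\<^esub>(F\<^sub>2)\<close> are read up to isomorphism. The last
  branch does not occur for an extra-special \<open>G\<close> of order \<open>2\<^bsup>2g+1\<^esup>\<close>.\<close>

definition A_factor :: "nat \<Rightarrow> ('a, 'b) monoid_scheme \<Rightarrow> nat" where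
  "A_factor g G =
    (if G \<cong> H_group g then 2 ^ (2 * g - 1) - 2 ^ (g - 1)
     else if G \<cong> G_group g then 2 ^ (2 * g - 1) + 2 ^ (g - 1)
     else undefined)"


section \<open>The symplectic group over the field with two elements\<close>

definition symplectic_J :: "nat \<Rightarrow> bit mat" where
  "symplectic_J g = four_block_mat (0\<^sub>m g g) (1\<^sub>m g) (- 1\<^sub>m g) (0\<^sub>m g g)"

definition Sp_F2 :: "nat \<Rightarrow> bit mat set" where
  "Sp_F2 g = {M \<in> carrier_mat (2 * g) (2 * g).
     transpose_mat M * symplectic_J g * M = symplectic_J g}"

end

theory Submission
  imports Defs
begin

text \<open>
  Let \<open>Z = {1, z}\<close> be the center of \<open>G\<close>. The quotient \<open>V = G / Z\<close> is a vector space of dimension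
  \<open>2g\<close> over the field with two elements. Commutators in \<open>G\<close> are powers of \<open>z\<close> and give a symplectic
  form \<open>c\<close> on \<open>V\<close>; squares are powers of \<open>z\<close> as well and give a quadratic form \<open>q\<close> with
  polarisation \<open>c\<close>. Everything below is linear algebra of \<open>(V, c, q)\<close>, carried out on elements of
  \<open>G\<close>.

  Let \<open>a\<^sub>i, b\<^sub>i, s\<close> be the images of the braid generators in \<open>G\<close>. The form \<open>c\<close> is bilinear and
  takes values in characteristic two, so the two factors \<open>\<sigma>\<close> or \<open>\<sigma>\<inverse>\<close> around the inner letter
  of each commutator relation cancel. What is left is (\<open>satisfies_braid_rels_iff\<close>): generators with
  different indices are orthogonal, \<open>c(a\<^sub>i, b\<^sub>i) = q(s)\<close> for every \<open>i\<close>, and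
  \<open>c(a\<^sub>1, b\<^sub>1) + \<dots> + c(a\<^sub>g, b\<^sub>g) = q(s)\<close>.

  If \<open>q(s) = 0\<close>, all \<open>a\<^sub>i\<close> and \<open>b\<^sub>i\<close> commute, and if they generate \<open>G\<close> together with \<open>s\<close> then \<open>G\<close> has
  at most eight elements, too few for \<open>g \<ge> 2\<close> (\<open>sq_form_sigma\<close>). An epimorphism therefore has \<open>q(s) = 1\<close>; then
  the \<open>a\<^sub>i, b\<^sub>i\<close> lift a symplectic basis, and the last relation reads \<open>g = 1\<close> modulo two, which
  forces \<open>g\<close> to be odd. Conversely, for odd \<open>g\<close> every lift of a symplectic basis and every \<open>s\<close> with
  \<open>q(s) = 1\<close> satisfy the relations; such a lift generates \<open>G\<close>, so the resulting homomorphism is onto,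
  and it is admissible because \<open>s \<noteq> 1\<close> (\<open>braid_family_iff\<close>, \<open>admissible_iff\<close>).

  It remains to count. In the coordinates of a fixed symplectic basis, symplectic bases are the
  matrices in \<open>Sp(2g)\<close>, and each basis vector has two lifts, which gives the factor
  \<open>2\<^bsup>2g\<^esup> |Sp(2g)|\<close> (\<open>card_symplectic_families\<close>). The number of \<open>s\<close> with \<open>q(s) = 1\<close> follows from
  the sum of \<open>(-1)\<^bsup>q\<^esup>\<close> over \<open>G\<close>: splitting off a symplectic pair \<open>u, v\<close> with \<open>q(u) = q(v)\<close>
  contributes a factor \<open>2\<close> or \<open>-2\<close> (\<open>sq_signed_sum_split\<close>). By Arf's classification there is a
  symplectic basis in which all values of \<open>q\<close> vanish except that both may be \<open>1\<close> on the last pair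
  (\<open>normal_family_exists\<close>). Its lifts satisfy the defining relations of \<open>H_group\<close> or
  \<open>G_group\<close>, so \<open>G\<close> is isomorphic to one of the two, and the number in question is \<open>2 A(G)\<close>
  (\<open>card_sq_form_1_A_factor\<close>).
\<close>

section \<open>Homomorphisms out of a presented group\<close>

primrec word_eval :: "('a, 'b) monoid_scheme \<Rightarrow> ('x \<Rightarrow> 'a) \<Rightarrow> 'x word \<Rightarrow> 'a" where
  "word_eval G f [] = \<one>\<^bsub>G\<^esub>"
| "word_eval G f (a # w) =
     (if snd a then f (fst a) else inv\<^bsub>G\<^esub> f (fst a)) \<otimes>\<^bsub>G\<^esub> word_eval G f w"

definition satisfies_rels ::
    "('a, 'b) monoid_scheme \<Rightarrow> 'x set \<Rightarrow> ('x word \<times> 'x word) set \<Rightarrow> ('x \<Rightarrow> 'a) \<Rightarrow> bool" where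
  "satisfies_rels G X R f \<longleftrightarrow>
     (\<forall>(u, v)\<in>R. u \<in> words X \<longrightarrow> v \<in> words X \<longrightarrow> word_eval G f u = word_eval G f v)"

lemma letter_in_words [simp]: "letter x \<in> words X \<longleftrightarrow> x \<in> X"
  by (simp add: letter_def)

lemma wcomm_in_words [simp]: "wcomm u v \<in> words X \<longleftrightarrow> u \<in> words X \<and> v \<in> words X"
  by (auto simp: wcomm_def)

lemma pres_class_in_carrier [simp]:
  "w \<in> words X \<Longrightarrow> pres_class X R w \<in> carrier (presented_group X R)"
  by (simp add: presented_group_def)

lemma word_eval_cong:
  "w \<in> words X \<Longrightarrow> (\<And>x. x \<in> X \<Longrightarrow> f x = h x) \<Longrightarrow> word_eval G f w = word_eval G h w"
  by (induction w) auto

context group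
begin

lemma word_eval_closed [simp]:
  assumes "f \<in> X \<rightarrow> carrier G" "w \<in> words X"
  shows "word_eval G f w \<in> carrier G"
  using assms(2)
proof (induction w)
  case (Cons a w)
  then have "f (fst a) \<in> carrier G" using assms(1) by auto
  with Cons show ?case by auto
qed simp

lemma word_eval_subgroup:
  assumes S: "subgroup S G" and f: "f \<in> X \<rightarrow> S" and w: "w \<in> words X"
  shows "word_eval G f w \<in> S"
  using w
proof (induction w)
  case Nil
  then show ?case using S by (simp add: subgroup.one_closed)
next
  case (Cons a w)
  then have "f (fst a) \<in> S" using f by auto
  with Cons show ?case
    using S by (auto intro: subgroup.m_closed subgroup.m_inv_closed)
qed

lemma word_eval_append:
  assumes f: "f \<in> X \<rightarrow> carrier G" and "u \<in> words X" "v \<in> words X"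
  shows "word_eval G f (u @ v) = word_eval G f u \<otimes> word_eval G f v"
  using assms(2)
proof (induction u)
  case Nil
  then show ?case using assms by simp
next
  case (Cons a u)
  then have "f (fst a) \<in> carrier G" using f by auto
  with Cons assms show ?case by (auto simp: m_assoc)
qed

lemma word_eval_letter:
  assumes "f \<in> X \<rightarrow> carrier G" "x \<in> X"
  shows "word_eval G f (letter x) = f x"
  using assms funcset_mem[OF assms] by (simp add: letter_def)

lemma word_eval_winv:
  assumes f: "f \<in> X \<rightarrow> carrier G" and "w \<in> words X"
  shows "word_eval G f (winv w) = inv (word_eval G f w)"
  using assms(2)
proof (induction w)
  case Nil
  then show ?case by (simp add: winv_def)
next
  case (Cons a w)
  then have a: "f (fst a) \<in> carrier G" using f by auto
  have "winv (a # w) = winv w @ [(fst a, \<not> snd a)]"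
    by (cases a) (simp add: winv_def)
  then have "word_eval G f (winv (a # w)) =
      inv (word_eval G f w) \<otimes> word_eval G f [(fst a, \<not> snd a)]"
    using Cons word_eval_append[OF f, of "winv w" "[(fst a, \<not> snd a)]"] by simp
  then show ?case using Cons a f by (auto simp: inv_mult_group)
qed

lemma word_eval_wcomm:
  assumes f: "f \<in> X \<rightarrow> carrier G" and "u \<in> words X" "v \<in> words X"
  shows "word_eval G f (wcomm u v) =
    word_eval G f u \<otimes> word_eval G f v \<otimes> inv (word_eval G f u) \<otimes> inv (word_eval G f v)"
  using assms by (simp add: wcomm_def word_eval_append[of f X] word_eval_winv[of f X]
      word_eval_closed[of f X] m_assoc)

lemma word_eval_pres_cong:
  assumes f: "f \<in> X \<rightarrow> carrier G" and R: "satisfies_rels G X R f"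
    and "pres_cong X R u v"
  shows "word_eval G f u = word_eval G f v"
  using assms(3)
proof (induction rule: pres_cong.induct)
  case (append u u' v v')
  then show ?case using word_eval_append[OF f] pres_cong_words by metis
next
  case (cancel x s)
  then have "f x \<in> carrier G" using f by auto
  then show ?case by auto
next
  case (rel u v)
  then show ?case using R by (auto simp: satisfies_rels_def)
qed auto

text \<open>The value on a class may be read off any representative, by \<open>word_eval_pres_cong\<close>. The lift is
  made extensional so that it is the unique preimage in the bijection below.\<close>

definition pres_lift ::
    "'x set \<Rightarrow> ('x word \<times> 'x word) set \<Rightarrow> ('x \<Rightarrow> 'a) \<Rightarrow> 'x word set \<Rightarrow> 'a" where
  "pres_lift X R f =
     (\<lambda>A\<in>carrier (presented_group X R). word_eval G f (SOME w. w \<in> A))"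

lemma pres_lift_class:
  assumes f: "f \<in> X \<rightarrow> carrier G" and R: "satisfies_rels G X R f" and w: "w \<in> words X"
  shows "pres_lift X R f (pres_class X R w) = word_eval G f w"
proof -
  have "w \<in> pres_class X R w" using w by (simp add: pres_class_def pres_cong.refl)
  then have "(SOME v. v \<in> pres_class X R w) \<in> pres_class X R w" by (rule someI)
  then have "pres_cong X R w (SOME v. v \<in> pres_class X R w)" by (simp add: pres_class_def)
  then show ?thesis
    using word_eval_pres_cong[OF f R] w by (simp add: pres_lift_def)
qed

lemma pres_lift_hom:
  assumes f: "f \<in> X \<rightarrow> carrier G" and R: "satisfies_rels G X R f"
  shows "pres_lift X R f \<in> hom (presented_group X R) G"
proof (rule homI)
  fix A assume "A \<in> carrier (presented_group X R)"
  then obtain u where "u \<in> words X" "A = pres_class X R u"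
    by (auto simp: presented_group_def)
  then show "pres_lift X R f A \<in> carrier G"
    using f pres_lift_class[OF f R] by simp
next
  fix A B assume "A \<in> carrier (presented_group X R)" "B \<in> carrier (presented_group X R)"
  then obtain u v where "u \<in> words X" "A = pres_class X R u" "v \<in> words X" "B = pres_class X R v"
    by (auto simp: presented_group_def)
  then show "pres_lift X R f (A \<otimes>\<^bsub>presented_group X R\<^esub> B) =
      pres_lift X R f A \<otimes> pres_lift X R f B"
    using pres_lift_class[OF f R] word_eval_append[OF f] by (simp add: presented_group_mult)
qed

lemma hom_pres_class:
  assumes h: "h \<in> hom (presented_group X R) G" and w: "w \<in> words X"
  shows "h (pres_class X R w) = word_eval G (\<lambda>x. h (pres_class X R (letter x))) w"
proof -
  interpret P: group "presented_group X R" by (rule group_presented_group)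
  interpret h: group_hom "presented_group X R" G h
    using h by unfold_locales
  have one: "pres_class X R [] = \<one>\<^bsub>presented_group X R\<^esub>" by (simp add: presented_group_def)
  show ?thesis
    using w
  proof (induction w)
    case Nil
    show ?case by (simp add: one)
  next
    case (Cons a w)
    obtain x s where a: "a = (x, s)" by (cases a)
    have x: "x \<in> X" "w \<in> words X" using Cons.prems a by auto
    have "pres_class X R [(x, False)] \<otimes>\<^bsub>presented_group X R\<^esub> pres_class X R (letter x) =
        pres_class X R []"
      using x pres_cong.cancel[of x X R False]
      by (simp add: presented_group_mult pres_class_eq_iff letter_def)
    then have inv: "pres_class X R [(x, False)] = inv\<^bsub>presented_group X R\<^esub> pres_class X R (letter x)"
      using x by (intro P.inv_equality[symmetric]) (simp_all add: one)
    have "pres_class X R (a # w) = pres_class X R [a] \<otimes>\<^bsub>presented_group X R\<^esub> pres_class X R w"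
      using x a by (simp add: presented_group_mult)
    then have "h (pres_class X R (a # w)) = h (pres_class X R [a]) \<otimes> h (pres_class X R w)"
      using x a by simp
    moreover have "h (pres_class X R [a]) =
        (if s then h (pres_class X R (letter x)) else inv h (pres_class X R (letter x)))"
      using x a inv by (simp add: letter_def)
    ultimately show ?case using Cons x a by simp
  qed
qed

lemma hom_satisfies_rels:
  assumes h: "h \<in> hom (presented_group X R) G"
  shows "satisfies_rels G X R (\<lambda>x. h (pres_class X R (letter x)))"
  unfolding satisfies_rels_def
proof safe
  fix u v assume uv: "(u, v) \<in> R" "u \<in> words X" "v \<in> words X"
  then have "pres_class X R u = pres_class X R v"
    by (simp add: pres_class_eq_iff pres_cong.rel)
  then show "word_eval G (\<lambda>x. h (pres_class X R (letter x))) u =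
      word_eval G (\<lambda>x. h (pres_class X R (letter x))) v"
    using uv hom_pres_class[OF h] by metis
qed

lemma satisfies_rels_cong:
  assumes "\<And>x. x \<in> X \<Longrightarrow> f x = h x"
  shows "satisfies_rels G X R f \<longleftrightarrow> satisfies_rels G X R h"
  unfolding satisfies_rels_def using word_eval_cong[of _ X f h G, OF _ assms] by fastforce

text \<open>The universal property of a presentation, as a bijection so that homomorphisms can be counted
  by the values on the generators.\<close>

lemma bij_betw_hom_presented_group:
  "bij_betw (\<lambda>h. \<lambda>x\<in>X. h (pres_class X R (letter x)))
     (hom (presented_group X R) G \<inter> extensional (carrier (presented_group X R)))
     {f \<in> X \<rightarrow>\<^sub>E carrier G. satisfies_rels G X R f}"
proof (rule bij_betw_byWitness[where f' = "pres_lift X R"])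
  let ?P = "presented_group X R"
  have ext: "h = h'" if "h \<in> extensional (carrier ?P)" "h' \<in> extensional (carrier ?P)"
    "\<And>w. w \<in> words X \<Longrightarrow> h (pres_class X R w) = h' (pres_class X R w)" for h h' :: "_ \<Rightarrow> 'a"
    using that by (intro extensionalityI[of h "carrier ?P" h'])
      (auto simp: presented_group_def)
  have res: "(\<lambda>x\<in>X. h (pres_class X R (letter x))) \<in> X \<rightarrow>\<^sub>E carrier G"
    and sat: "satisfies_rels G X R (\<lambda>x\<in>X. h (pres_class X R (letter x)))"
    if "h \<in> hom ?P G" for h
  proof -
    show "(\<lambda>x\<in>X. h (pres_class X R (letter x))) \<in> X \<rightarrow>\<^sub>E carrier G"
      using that by (auto intro: hom_in_carrier)
    show "satisfies_rels G X R (\<lambda>x\<in>X. h (pres_class X R (letter x)))"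
      using hom_satisfies_rels[OF that] by (subst satisfies_rels_cong) auto
  qed
  show "\<forall>h\<in>hom ?P G \<inter> extensional (carrier ?P).
      pres_lift X R (\<lambda>x\<in>X. h (pres_class X R (letter x))) = h"
  proof
    fix h assume h: "h \<in> hom ?P G \<inter> extensional (carrier ?P)"
    show "pres_lift X R (\<lambda>x\<in>X. h (pres_class X R (letter x))) = h"
    proof (rule ext)
      fix w assume w: "w \<in> words X"
      have "pres_lift X R (\<lambda>x\<in>X. h (pres_class X R (letter x))) (pres_class X R w) =
          word_eval G (\<lambda>x\<in>X. h (pres_class X R (letter x))) w"
        using h res[of h] sat[of h] w by (intro pres_lift_class) auto
      also have "\<dots> = word_eval G (\<lambda>x. h (pres_class X R (letter x))) w"
        using w by (rule word_eval_cong) simp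
      also have "\<dots> = h (pres_class X R w)"
        using h w hom_pres_class[of h X R w] by simp
      finally show "pres_lift X R (\<lambda>x\<in>X. h (pres_class X R (letter x))) (pres_class X R w) =
          h (pres_class X R w)" .
    qed (use h in \<open>auto simp: pres_lift_def\<close>)
  qed
  show "\<forall>f\<in>{f \<in> X \<rightarrow>\<^sub>E carrier G. satisfies_rels G X R f}.
      (\<lambda>x\<in>X. pres_lift X R f (pres_class X R (letter x))) = f"
  proof
    fix f assume f: "f \<in> {f \<in> X \<rightarrow>\<^sub>E carrier G. satisfies_rels G X R f}"
    then have "f \<in> X \<rightarrow> carrier G" by auto
    with f have "pres_lift X R f (pres_class X R (letter x)) = f x" if "x \<in> X" for x
      using that pres_lift_class[of f X R "letter x"] word_eval_letter[of f X x] by simp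
    then show "(\<lambda>x\<in>X. pres_lift X R f (pres_class X R (letter x))) = f"
      using f by (intro extensionalityI[of _ X]) (auto simp: PiE_def)
  qed
  show "(\<lambda>h. \<lambda>x\<in>X. h (pres_class X R (letter x))) ` (hom ?P G \<inter> extensional (carrier ?P))
      \<subseteq> {f \<in> X \<rightarrow>\<^sub>E carrier G. satisfies_rels G X R f}"
    using res sat by blast
  show "pres_lift X R ` {f \<in> X \<rightarrow>\<^sub>E carrier G. satisfies_rels G X R f}
      \<subseteq> hom ?P G \<inter> extensional (carrier ?P)"
    using pres_lift_hom[of _ X R] by (auto simp: pres_lift_def)
qed

text \<open>The image of a homomorphism is the smallest subgroup that contains the images of the generators.
  Surjectivity thereby becomes a condition on these images alone.\<close>

lemma epi_presented_group_iff:
  assumes h: "h \<in> hom (presented_group X R) G"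
  shows "h \<in> epi (presented_group X R) G \<longleftrightarrow>
    (\<forall>S. subgroup S G \<longrightarrow> (\<forall>x\<in>X. h (pres_class X R (letter x)) \<in> S) \<longrightarrow> S = carrier G)"
proof
  assume epi: "h \<in> epi (presented_group X R) G"
  show "\<forall>S. subgroup S G \<longrightarrow> (\<forall>x\<in>X. h (pres_class X R (letter x)) \<in> S) \<longrightarrow> S = carrier G"
  proof (intro allI impI)
    fix S assume S: "subgroup S G" "\<forall>x\<in>X. h (pres_class X R (letter x)) \<in> S"
    have "h (pres_class X R w) \<in> S" if "w \<in> words X" for w
      using word_eval_subgroup[OF S(1), of _ X w] S(2) that hom_pres_class[OF h that] by auto
    moreover have "carrier G = h ` pres_class X R ` words X"
      using epi by (simp add: epi_def presented_group_def)
    ultimately have "carrier G \<subseteq> S" by auto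
    then show "S = carrier G" using S(1) by (simp add: subgroup.subset subset_antisym)
  qed
next
  interpret P: group "presented_group X R" by (rule group_presented_group)
  interpret h: group_hom "presented_group X R" G h
    using h by unfold_locales
  assume "\<forall>S. subgroup S G \<longrightarrow> (\<forall>x\<in>X. h (pres_class X R (letter x)) \<in> S) \<longrightarrow> S = carrier G"
  then have "h ` carrier (presented_group X R) = carrier G"
    using h.img_is_subgroup by simp
  then show "h \<in> epi (presented_group X R) G"
    using h by (simp add: epi_def)
qed

end


section \<open>The commutator form and the squaring form\<close>

text \<open>The default simplification turns sums of bits into Boolean expressions; here they have to stay
  visible as field operations.\<close>

declare add_bit_eq_xor [simp del] mult_bit_eq_and [simp del]

lemma bit_add_self [simp]: "b + b = (0 :: bit)" "b + (b + d) = (d :: bit)"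
proof -
  show "b + b = 0" by (cases b) auto
  then show "b + (b + d) = d" by (simp add: add.assoc[symmetric])
qed

lemma bit_add_eq_0_iff: "a + b = 0 \<longleftrightarrow> a = (b :: bit)"
  by (cases a; cases b) auto

text \<open>An extra-special two-group, described by the equations that are used for computing in \<open>G\<close> itself:
  the last two assumptions say that the quotient by the center is elementary abelian.\<close>

locale extraspecial_two_group = group G for G (structure) +
  fixes z
  assumes finite_carrier: "finite (carrier G)"
    and center_eq: "group_center G = {\<one>, z}"
    and z_neq_one: "z \<noteq> \<one>"
    and commute_up_to_z: "\<lbrakk>x \<in> carrier G; y \<in> carrier G\<rbrakk> \<Longrightarrow>
      x \<otimes> y = y \<otimes> x \<or> x \<otimes> y = z \<otimes> (y \<otimes> x)"
    and square_in_center: "x \<in> carrier G \<Longrightarrow> x \<otimes> x = \<one> \<or> x \<otimes> x = z"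
begin

definition zpow :: "bit \<Rightarrow> 'a" where
  "zpow b = (if b = 0 then \<one> else z)"

definition comm_form :: "'a \<Rightarrow> 'a \<Rightarrow> bit" where
  "comm_form x y = (if x \<otimes> y = y \<otimes> x then 0 else 1)"

definition sq_form :: "'a \<Rightarrow> bit" where
  "sq_form x = (if x \<otimes> x = \<one> then 0 else 1)"

lemma z_closed [simp]: "z \<in> carrier G"
  and z_commutes: "x \<in> carrier G \<Longrightarrow> x \<otimes> z = z \<otimes> x"
proof -
  have "z \<in> group_center G" using center_eq by simp
  then show "z \<in> carrier G" "x \<in> carrier G \<Longrightarrow> x \<otimes> z = z \<otimes> x"
    by (auto simp: group_center_def)
qed

lemma z_left_commute: "\<lbrakk>x \<in> carrier G; y \<in> carrier G\<rbrakk> \<Longrightarrow> x \<otimes> (z \<otimes> y) = z \<otimes> (x \<otimes> y)"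
  using m_assoc[of x z y] m_assoc[of z x y] by (simp add: z_commutes)

lemma z_square: "z \<otimes> z = \<one>"
  using square_in_center[of z] z_neq_one by auto

lemma zpow_closed [simp]: "zpow b \<in> carrier G"
  by (simp add: zpow_def)

lemma zpow_simps [simp]: "zpow 0 = \<one>" "zpow 1 = z"
  by (simp_all add: zpow_def)

lemma zpow_add: "zpow (b + d) = zpow b \<otimes> zpow d"
  by (cases b; cases d) (simp_all add: z_square)

lemma zpow_inj [simp]: "zpow b = zpow d \<longleftrightarrow> b = d"
  using z_neq_one by (cases b; cases d) auto

lemma zpow_eq_one [simp]: "zpow b = \<one> \<longleftrightarrow> b = 0"
  using zpow_inj[of b 0] by (simp del: zpow_inj)

lemma inv_zpow [simp]: "inv (zpow b) = zpow b"
  by (rule inv_equality) (simp_all flip: zpow_add)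

lemma zpow_left_commute:
  "\<lbrakk>x \<in> carrier G; y \<in> carrier G\<rbrakk> \<Longrightarrow> x \<otimes> (zpow b \<otimes> y) = zpow b \<otimes> (x \<otimes> y)"
  by (cases b) (simp_all add: z_left_commute)

lemma comm_form_mult_swap:
  "\<lbrakk>x \<in> carrier G; y \<in> carrier G\<rbrakk> \<Longrightarrow> x \<otimes> y = zpow (comm_form x y) \<otimes> (y \<otimes> x)"
  using commute_up_to_z[of x y] by (auto simp: comm_form_def)

lemma comm_form_eqI:
  assumes "x \<in> carrier G" "y \<in> carrier G" "x \<otimes> y = zpow b \<otimes> (y \<otimes> x)"
  shows "comm_form x y = b"
proof -
  have "zpow b \<otimes> (y \<otimes> x) = zpow (comm_form x y) \<otimes> (y \<otimes> x)"
    using assms comm_form_mult_swap by metis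
  then have "zpow b = zpow (comm_form x y)"
    using assms by simp
  then show ?thesis by simp
qed

lemma square_zpow: "x \<in> carrier G \<Longrightarrow> x \<otimes> x = zpow (sq_form x)"
  using square_in_center[of x] by (auto simp: sq_form_def)

lemma sq_form_eqI: "\<lbrakk>x \<in> carrier G; x \<otimes> x = zpow b\<rbrakk> \<Longrightarrow> sq_form x = b"
  by (simp add: square_zpow)

lemma comm_form_self [simp]: "comm_form x x = 0"
  by (simp add: comm_form_def)

lemma comm_form_sym: "comm_form x y = comm_form y x"
  by (auto simp: comm_form_def)

text \<open>Commutators are central, so commuting \<open>w\<close> past a product commutes it past the factors one after the
  other.\<close>

lemma comm_form_mult_left:
  assumes [simp]: "x \<in> carrier G" "y \<in> carrier G" "w \<in> carrier G"
  shows "comm_form (x \<otimes> y) w = comm_form x w + comm_form y w"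
proof (rule comm_form_eqI)
  have "(x \<otimes> y) \<otimes> w = x \<otimes> (zpow (comm_form y w) \<otimes> (w \<otimes> y))"
    by (simp add: m_assoc comm_form_mult_swap[of y w])
  also have "\<dots> = zpow (comm_form y w) \<otimes> (x \<otimes> w \<otimes> y)"
    by (simp add: zpow_left_commute m_assoc)
  also have "\<dots> = zpow (comm_form y w) \<otimes> (zpow (comm_form x w) \<otimes> (w \<otimes> x) \<otimes> y)"
    by (simp add: comm_form_mult_swap[of x w])
  also have "\<dots> = zpow (comm_form x w + comm_form y w) \<otimes> (w \<otimes> (x \<otimes> y))"
    by (simp add: add.commute[of "comm_form x w"] zpow_add m_assoc)
  finally show "(x \<otimes> y) \<otimes> w = zpow (comm_form x w + comm_form y w) \<otimes> (w \<otimes> (x \<otimes> y))" .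
qed auto

lemma comm_form_mult_right:
  "\<lbrakk>x \<in> carrier G; y \<in> carrier G; w \<in> carrier G\<rbrakk> \<Longrightarrow>
    comm_form w (x \<otimes> y) = comm_form w x + comm_form w y"
  using comm_form_mult_left[of x y w] by (simp add: comm_form_sym)

lemma comm_form_one [simp]: "x \<in> carrier G \<Longrightarrow> comm_form \<one> x = 0"
  "x \<in> carrier G \<Longrightarrow> comm_form x \<one> = 0"
  by (simp_all add: comm_form_def)

lemma comm_form_z [simp]: "x \<in> carrier G \<Longrightarrow> comm_form z x = 0"
  "x \<in> carrier G \<Longrightarrow> comm_form x z = 0"
  by (simp_all add: comm_form_def z_commutes)

lemma comm_form_inv_left [simp]:
  assumes "x \<in> carrier G" "y \<in> carrier G"
  shows "comm_form (inv x) y = comm_form x y"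
  using comm_form_mult_left[of x "inv x" y] assms by (simp add: bit_add_eq_0_iff)

lemma comm_form_inv_right [simp]:
  "\<lbrakk>x \<in> carrier G; y \<in> carrier G\<rbrakk> \<Longrightarrow> comm_form x (inv y) = comm_form x y"
  by (subst (1 2) comm_form_sym) simp

lemma commutator_eq:
  assumes [simp]: "x \<in> carrier G" "y \<in> carrier G"
  shows "x \<otimes> y \<otimes> inv x \<otimes> inv y = zpow (comm_form x y)"
proof -
  have "x \<otimes> y \<otimes> inv x \<otimes> inv y = (x \<otimes> y) \<otimes> inv (y \<otimes> x)"
    by (simp add: inv_mult_group m_assoc)
  also have "\<dots> = zpow (comm_form x y) \<otimes> ((y \<otimes> x) \<otimes> inv (y \<otimes> x))"
    by (simp add: comm_form_mult_swap[of x y] m_assoc del: r_inv)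
  also have "(y \<otimes> x) \<otimes> inv (y \<otimes> x) = \<one>"
    by (intro r_inv) simp
  finally show ?thesis by simp
qed

text \<open>The squaring form is quadratic, with the commutator form as its polarisation.\<close>

lemma sq_form_mult:
  assumes [simp]: "x \<in> carrier G" "y \<in> carrier G"
  shows "sq_form (x \<otimes> y) = sq_form x + sq_form y + comm_form x y"
proof (rule sq_form_eqI)
  have "(x \<otimes> y) \<otimes> (x \<otimes> y) = x \<otimes> ((y \<otimes> x) \<otimes> y)"
    by (simp add: m_assoc)
  also have "y \<otimes> x = zpow (comm_form x y) \<otimes> (x \<otimes> y)"
    using comm_form_mult_swap[of y x] by (simp add: comm_form_sym)
  also have "x \<otimes> (zpow (comm_form x y) \<otimes> (x \<otimes> y) \<otimes> y) =
      zpow (comm_form x y) \<otimes> ((x \<otimes> x) \<otimes> (y \<otimes> y))"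
    by (simp add: m_assoc zpow_left_commute)
  also have "\<dots> = zpow (sq_form x + sq_form y + comm_form x y)"
    by (simp add: square_zpow add.commute flip: zpow_add)
  finally show "(x \<otimes> y) \<otimes> (x \<otimes> y) = zpow (sq_form x + sq_form y + comm_form x y)" .
qed simp

lemma sq_form_one [simp]: "sq_form \<one> = 0"
  and sq_form_z [simp]: "sq_form z = 0"
  by (simp_all add: sq_form_def z_square)

lemma comm_form_radical:
  assumes "x \<in> carrier G" "\<And>y. y \<in> carrier G \<Longrightarrow> comm_form x y = 0"
  shows "x \<in> {\<one>, z}"
proof -
  have "x \<otimes> y = y \<otimes> x" if "y \<in> carrier G" for y
    using assms(2)[OF that] by (simp add: comm_form_def split: if_splits)
  then show ?thesis using assms(1) center_eq by (auto simp: group_center_def)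
qed

lemma card_center: "card {\<one>, z} = 2"
  using z_neq_one by simp

lemma subgroup_comm_kernel:
  assumes "T \<subseteq> carrier G"
  shows "subgroup {x \<in> carrier G. \<forall>t\<in>T. comm_form x t = 0} G"
  using assms by (intro subgroupI) (auto simp: comm_form_mult_left subset_iff)

subsection \<open>Splitting off a hyperbolic pair\<close>

definition perp :: "'a set \<Rightarrow> 'a \<Rightarrow> 'a \<Rightarrow> 'a set" where
  "perp C u v = {x \<in> C. comm_form x u = 0 \<and> comm_form x v = 0}"

text \<open>The values of \<open>c(x, u)\<close> and \<open>c(x, v)\<close> divide \<open>C\<close> into four parts. Right multiplication by \<open>u\<close>,
  \<open>v\<close> and \<open>uv\<close> moves \<open>perp C u v\<close> onto the other three, because \<open>c(u, v) = 1\<close>. The lemma serves both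
  for counting elements and for summing signs.\<close>

lemma sum_split_pair:
  assumes C: "subgroup C G" and u: "u \<in> C" and v: "v \<in> C" and uv: "comm_form u v = 1"
  shows "sum f C =
    (\<Sum>x\<in>perp C u v. f x + f (x \<otimes> u) + f (x \<otimes> v) + f (x \<otimes> (u \<otimes> v)))"
proof -
  have sub: "C \<subseteq> carrier G" using C by (rule subgroup.subset)
  have [simp]: "u \<in> carrier G" "v \<in> carrier G" using u v sub by auto
  have vu: "comm_form v u = 1" using uv comm_form_sym by metis
  define P where "P a b = {x \<in> C. comm_form x u = a \<and> comm_form x v = b}" for a b
  have fin: "finite C" using sub finite_carrier finite_subset by blast
  have shift: "sum f (P (comm_form t u) (comm_form t v)) = (\<Sum>x\<in>P 0 0. f (x \<otimes> t))"
    if t: "t \<in> C" for t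
  proof (rule sum.reindex_bij_witness[where i = "\<lambda>x. x \<otimes> t" and j = "\<lambda>x. x \<otimes> inv t"])
    have [simp]: "t \<in> carrier G" "inv t \<in> C" using t sub C by (auto intro: subgroup.m_inv_closed)
    fix x
    {
      assume "x \<in> P (comm_form t u) (comm_form t v)"
      then have x: "x \<in> C" "x \<in> carrier G" "comm_form x u = comm_form t u"
        "comm_form x v = comm_form t v" using sub by (auto simp: P_def)
      then show "x \<otimes> inv t \<otimes> t = x" by (simp add: m_assoc)
      then show "f (x \<otimes> inv t \<otimes> t) = f x" by simp
      show "x \<otimes> inv t \<in> P 0 0"
        using x C by (simp add: P_def comm_form_mult_left subgroup.m_closed)
    }
    assume "x \<in> P 0 0"
    then have x: "x \<in> C" "x \<in> carrier G" "comm_form x u = 0" "comm_form x v = 0"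
      using sub by (auto simp: P_def)
    then show "x \<otimes> t \<otimes> inv t = x" by (simp add: m_assoc)
    show "x \<otimes> t \<in> P (comm_form t u) (comm_form t v)"
      using x C t by (simp add: P_def comm_form_mult_left subgroup.m_closed)
  qed
  have "C = (P 0 0 \<union> P 0 1) \<union> (P 1 0 \<union> P 1 1)"
    by (auto simp: P_def)
  moreover have "finite (P a b)" for a b using fin by (simp add: P_def)
  moreover have "P a b \<inter> P a' b' = {}" if "a \<noteq> a' \<or> b \<noteq> b'" for a b a' b'
    using that by (auto simp: P_def)
  ultimately have "sum f C = sum f (P 0 0) + sum f (P 0 1) + (sum f (P 1 0) + sum f (P 1 1))"
    by (subst \<open>C = _\<close>, subst sum.union_disjoint) (auto simp: sum.union_disjoint Int_Un_distrib Int_Un_distrib2)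
  also have "sum f (P 0 1) = (\<Sum>x\<in>P 0 0. f (x \<otimes> u))"
    using shift[OF u] by (simp add: uv)
  also have "sum f (P 1 0) = (\<Sum>x\<in>P 0 0. f (x \<otimes> v))"
    using shift[OF v] by (simp add: vu)
  also have "sum f (P 1 1) = (\<Sum>x\<in>P 0 0. f (x \<otimes> (u \<otimes> v)))"
    using shift[of "u \<otimes> v"] u v C by (simp add: uv vu comm_form_mult_left subgroup.m_closed)
  finally show ?thesis
    by (simp add: perp_def P_def sum.distrib add.assoc)
qed

lemma card_split_pair:
  assumes "subgroup C G" "u \<in> C" "v \<in> C" "comm_form u v = 1"
  shows "card C = 4 * card (perp C u v)"
  using sum_split_pair[OF assms, of "\<lambda>_. 1 :: nat"] by simp

lemma perp_adjust:
  assumes C: "subgroup C G" and u: "u \<in> C" and v: "v \<in> C" and uv: "comm_form u v = 1"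
    and x: "x \<in> C"
  obtains t where "t \<in> {\<one>, u, v, u \<otimes> v}" "x \<otimes> t \<in> perp C u v"
proof -
  have [simp]: "u \<in> carrier G" "v \<in> carrier G" "x \<in> carrier G"
    using u v x subgroup.subset[OF C] by auto
  have vu: "comm_form v u = 1" using uv comm_form_sym by metis
  note C' = subgroup.m_closed[OF C]
  show ?thesis
  proof (cases "comm_form x u"; cases "comm_form x v")
    assume "comm_form x u = 0" "comm_form x v = 0"
    then show ?thesis using x by (intro that[of \<one>]) (auto simp: perp_def)
  next
    assume "comm_form x u = 0" "comm_form x v = 1"
    then show ?thesis using x u uv
      by (intro that[of u]) (auto simp: perp_def comm_form_mult_left C')
  next
    assume "comm_form x u = 1" "comm_form x v = 0"
    then show ?thesis using x v vu
      by (intro that[of v]) (auto simp: perp_def comm_form_mult_left C')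
  next
    assume "comm_form x u = 1" "comm_form x v = 1"
    then show ?thesis using x u v uv vu
      by (intro that[of "u \<otimes> v"]) (auto simp: perp_def comm_form_mult_left C')
  qed
qed

subsection \<open>Symplectic families\<close>

text \<open>Lifts to \<open>G\<close> of \<open>k\<close> orthogonal hyperbolic pairs of the symplectic space \<open>V\<close>.\<close>

definition symplectic_family :: "nat \<Rightarrow> (nat \<Rightarrow> 'a) \<Rightarrow> (nat \<Rightarrow> 'a) \<Rightarrow> bool" where
  "symplectic_family k X Y \<longleftrightarrow>
     X \<in> {..<k} \<rightarrow> carrier G \<and> Y \<in> {..<k} \<rightarrow> carrier G \<and>
     (\<forall>i<k. \<forall>j<k. comm_form (X i) (X j) = 0 \<and> comm_form (Y i) (Y j) = 0 \<and>
        comm_form (X i) (Y j) = of_bool (i = j))"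

definition family_centralizer :: "nat \<Rightarrow> (nat \<Rightarrow> 'a) \<Rightarrow> (nat \<Rightarrow> 'a) \<Rightarrow> 'a set" where
  "family_centralizer k X Y =
     {x \<in> carrier G. \<forall>i<k. comm_form x (X i) = 0 \<and> comm_form x (Y i) = 0}"

lemma symplectic_family_closed:
  assumes "symplectic_family k X Y" "i < k"
  shows "X i \<in> carrier G" "Y i \<in> carrier G"
  using assms by (auto simp: symplectic_family_def)

lemma symplectic_family_mono: "symplectic_family k X Y \<Longrightarrow> l \<le> k \<Longrightarrow> symplectic_family l X Y"
  by (auto simp: symplectic_family_def Pi_iff)

lemma family_centralizer_0: "family_centralizer 0 X Y = carrier G"
  by (simp add: family_centralizer_def)

lemma subgroup_family_centralizer:
  assumes "symplectic_family k X Y"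
  shows "subgroup (family_centralizer k X Y) G"
proof -
  have "family_centralizer k X Y =
      {x \<in> carrier G. \<forall>t\<in>X ` {..<k} \<union> Y ` {..<k}. comm_form x t = 0}"
    by (auto simp: family_centralizer_def)
  then show ?thesis
    using subgroup_comm_kernel[of "X ` {..<k} \<union> Y ` {..<k}"] symplectic_family_closed[OF assms]
    by auto
qed

lemma family_centralizer_Suc:
  "family_centralizer (Suc k) X Y = perp (family_centralizer k X Y) (X k) (Y k)"
  by (auto simp: family_centralizer_def perp_def less_Suc_eq)

text \<open>With \<open>family_centralizer_Suc\<close> this allows families to be built and taken apart one pair at a time.\<close>

lemma symplectic_family_Suc:
  "symplectic_family (Suc k) X Y \<longleftrightarrow> symplectic_family k X Y \<and>
    X k \<in> family_centralizer k X Y \<and> Y k \<in> family_centralizer k X Y \<and> comm_form (X k) (Y k) = 1"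
    (is "?L \<longleftrightarrow> ?R")
proof
  assume L: ?L
  then have "comm_form (Y k) (X i) = 0" if "i < k" for i
    using that by (subst comm_form_sym) (auto simp: symplectic_family_def)
  with L show ?R by (auto simp: symplectic_family_def family_centralizer_def)
next
  assume R: ?R
  then have "comm_form (X i) (X k) = 0" "comm_form (X i) (Y k) = 0" "comm_form (Y i) (Y k) = 0"
    if "i < k" for i
    using that by (subst comm_form_sym; simp add: family_centralizer_def)+
  with R show ?L by (auto simp: symplectic_family_def family_centralizer_def less_Suc_eq)
qed

lemma symplectic_family_pair:
  assumes "symplectic_family k X Y" "i < k"
  shows "subgroup (family_centralizer i X Y) G" "X i \<in> family_centralizer i X Y"
    "Y i \<in> family_centralizer i X Y" "comm_form (X i) (Y i) = 1"
  using symplectic_family_mono[OF assms(1), of "Suc i"] assms(2)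
  by (auto simp: symplectic_family_Suc subgroup_family_centralizer)

lemma card_family_centralizer:
  assumes "symplectic_family k X Y"
  shows "card (carrier G) = 4 ^ k * card (family_centralizer k X Y)"
  using assms
proof (induction k)
  case (Suc k)
  then show ?case
    using card_split_pair[OF symplectic_family_pair[OF Suc.prems lessI]]
    by (simp add: symplectic_family_Suc family_centralizer_Suc)
qed (simp add: family_centralizer_0)

lemma center_subset_family_centralizer:
  "symplectic_family k X Y \<Longrightarrow> {\<one>, z} \<subseteq> family_centralizer k X Y"
  using symplectic_family_closed[of k X Y] by (auto simp: family_centralizer_def)

text \<open>The orthogonal complement of a nondegenerate subspace is nondegenerate: a partner of \<open>x\<close> found
  one level higher is moved into the complement by members of the family, which pair trivially with \<open>x\<close>.\<close>

lemma family_centralizer_nondegenerate: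
  assumes "symplectic_family k X Y" "x \<in> family_centralizer k X Y" "x \<notin> {\<one>, z}"
  obtains y where "y \<in> family_centralizer k X Y" "comm_form x y = 1"
proof -
  have "\<exists>y\<in>family_centralizer k X Y. comm_form x y = 1"
    using assms
  proof (induction k)
    case 0
    then show ?case
      unfolding family_centralizer_0 using comm_form_radical[of x] bit_not_one_iff by blast
  next
    case (Suc k)
    note pair = symplectic_family_pair[OF Suc.prems(1) lessI]
    have x: "x \<in> carrier G" "comm_form x (X k) = 0" "comm_form x (Y k) = 0"
        "x \<in> family_centralizer k X Y"
      using Suc.prems(2) by (auto simp: family_centralizer_def)
    obtain y where y: "y \<in> family_centralizer k X Y" "comm_form x y = 1"
      using Suc x by (auto simp: symplectic_family_Suc)
    obtain t where t: "t \<in> {\<one>, X k, Y k, X k \<otimes> Y k}"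
        "y \<otimes> t \<in> family_centralizer (Suc k) X Y"
      using perp_adjust[OF pair y(1)] by (auto simp: family_centralizer_Suc)
    have XY: "X k \<in> carrier G" "Y k \<in> carrier G" "y \<in> carrier G"
      using pair y by (auto simp: family_centralizer_def)
    then have "t \<in> carrier G" "comm_form x t = 0"
      using t x by (auto simp: comm_form_mult_right)
    then have "comm_form x (y \<otimes> t) = 1"
      using x y XY by (simp add: comm_form_mult_right)
    with t show ?case by blast
  qed
  then show ?thesis using that by blast
qed

text \<open>Every element is moved by members of the family, one pair after the other, into the common
  centralizer, which is the center.\<close>

lemma symplectic_family_generates:
  assumes F: "symplectic_family k X Y" and C: "family_centralizer k X Y = {\<one>, z}"
    and S: "subgroup S G" "z \<in> S" "X \<in> {..<k} \<rightarrow> S" "Y \<in> {..<k} \<rightarrow> S"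
  shows "S = carrier G"
proof -
  have "family_centralizer (k - l) X Y \<subseteq> S" if "l \<le> k" for l
    using that
  proof (induction l)
    case 0
    then show ?case using C S by (simp add: subgroup.one_closed)
  next
    case (Suc l)
    define i where "i = k - Suc l"
    have i: "i < k" "Suc i = k - l" using Suc.prems by (auto simp: i_def)
    show ?case
      unfolding i_def[symmetric]
    proof
      fix x assume x: "x \<in> family_centralizer i X Y"
      note pair = symplectic_family_pair[OF F i(1)]
      obtain t where t: "t \<in> {\<one>, X i, Y i, X i \<otimes> Y i}"
          "x \<otimes> t \<in> family_centralizer (Suc i) X Y"
        using perp_adjust[OF pair x] by (auto simp: family_centralizer_Suc)
      have "X i \<in> S" "Y i \<in> S" using S i by auto
      then have tS: "t \<in> S" using t(1) S by (auto intro: subgroup.m_closed subgroup.one_closed)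
      have xt: "x \<otimes> t \<in> S" using t(2) Suc i by auto
      have [simp]: "x \<in> carrier G" "t \<in> carrier G"
        using x tS subgroup.subset[OF S(1)] by (auto simp: family_centralizer_def)
      have "x = (x \<otimes> t) \<otimes> inv t" by (simp add: m_assoc)
      then show "x \<in> S"
        using xt tS S by (metis subgroup.m_closed subgroup.m_inv_closed)
    qed
  qed
  from this[of k] have "carrier G \<subseteq> S" by (simp add: family_centralizer_0)
  then show ?thesis using subgroup.subset[OF S(1)] by simp
qed

subsection \<open>Counting the zeros of the squaring form\<close>

definition bit_sign :: "bit \<Rightarrow> int" where
  "bit_sign b = (if b = 0 then 1 else - 1)"

text \<open>A Gauss sum of the quadratic form: it measures how far the values \<open>0\<close> and \<open>1\<close> are from being equally
  frequent.\<close>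

definition sq_signed_sum :: "'a set \<Rightarrow> int" where
  "sq_signed_sum C = (\<Sum>x\<in>C. bit_sign (sq_form x))"

lemma bit_sign_simps [simp]: "bit_sign 0 = 1" "bit_sign 1 = - 1"
  by (simp_all add: bit_sign_def)

lemma bit_sign_add: "bit_sign (a + b) = bit_sign a * bit_sign b"
  by (cases a; cases b) auto

text \<open>Over the four cosets of \<open>perp C u v\<close> the form differs by \<open>0\<close>, \<open>q(u)\<close>, \<open>q(v)\<close> and
  \<open>q(u) + q(v) + 1\<close>. The sign of the last is \<open>-1\<close> whenever \<open>q(u) = q(v)\<close>, so the four signs add up to
  \<open>1 + 1 + 1 - 1\<close> or to \<open>1 - 1 - 1 - 1\<close>.\<close>

lemma sq_signed_sum_split:
  assumes C: "subgroup C G" "u \<in> C" "v \<in> C" "comm_form u v = 1"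
    and q: "sq_form u = e" "sq_form v = e"
  shows "sq_signed_sum C = (if e = 0 then 2 else - 2) * sq_signed_sum (perp C u v)"
proof -
  have [simp]: "u \<in> carrier G" "v \<in> carrier G" using C subgroup.subset by blast+
  have "bit_sign (sq_form x) + bit_sign (sq_form (x \<otimes> u)) + bit_sign (sq_form (x \<otimes> v)) +
      bit_sign (sq_form (x \<otimes> (u \<otimes> v))) = (if e = 0 then 2 else - 2) * bit_sign (sq_form x)"
    if "x \<in> perp C u v" for x
  proof -
    have "x \<in> carrier G" "comm_form x u = 0" "comm_form x v = 0"
      using that subgroup.subset[OF C(1)] by (auto simp: perp_def)
    then show ?thesis
      using C q by (cases e) (simp_all add: sq_form_mult comm_form_mult_right bit_sign_add)
  qed
  then show ?thesis
    by (simp add: sq_signed_sum_def sum_split_pair[OF C] sum_distrib_left cong: sum.cong)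
qed

lemma sq_signed_sum_center: "sq_signed_sum {\<one>, z} = 2"
  using z_neq_one by (simp add: sq_signed_sum_def)

lemma sq_signed_sum_carrier:
  assumes "symplectic_family k X Y" "\<And>i. i < k \<Longrightarrow> sq_form (X i) = 0"
    "\<And>i. i < k \<Longrightarrow> sq_form (Y i) = 0"
  shows "sq_signed_sum (carrier G) = 2 ^ k * sq_signed_sum (family_centralizer k X Y)"
  using assms
proof (induction k)
  case (Suc k)
  then show ?case
    using sq_signed_sum_split[OF symplectic_family_pair[OF Suc.prems(1) lessI], of 0]
    by (simp add: symplectic_family_Suc family_centralizer_Suc)
qed (simp add: family_centralizer_0)

lemma card_sq_form_1:
  "2 * int (card {x \<in> carrier G. sq_form x = 1}) = int (card (carrier G)) - sq_signed_sum (carrier G)"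
proof -
  have "int (card (carrier G)) - sq_signed_sum (carrier G) =
      (\<Sum>x\<in>carrier G. 1 - bit_sign (sq_form x))"
    by (simp add: sq_signed_sum_def sum_subtractf)
  also have "\<dots> = (\<Sum>x\<in>carrier G. if sq_form x = 1 then 2 else 0)"
    by (intro sum.cong) (auto simp: bit_sign_def)
  also have "\<dots> = 2 * int (card {x \<in> carrier G. sq_form x = 1})"
    using finite_carrier by (simp add: sum.If_cases Int_def)
  finally show ?thesis by simp
qed

end


section \<open>Normal forms of extra-special two-groups\<close>

text \<open>Equations between cosets of a center with two elements become equations in \<open>G\<close> up to the factor \<open>z\<close>.\<close>

lemma extra_special_imp_extraspecial_two_group:
  assumes "extra_special 2 G"
  shows "\<exists>z. extraspecial_two_group G z"
proof -
  interpret group G using assms by (simp add: extra_special_def)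
  let ?Z = "group_center G"
  have sub: "subgroup ?Z G"
  proof (rule subgroupI)
    show "?Z \<noteq> {}" by (auto simp: group_center_def intro!: exI[of _ "\<one>\<^bsub>G\<^esub>"])
  next
    fix a assume "a \<in> ?Z"
    then have a: "a \<in> carrier G" "\<And>x. x \<in> carrier G \<Longrightarrow> a \<otimes>\<^bsub>G\<^esub> x = x \<otimes>\<^bsub>G\<^esub> a"
      by (auto simp: group_center_def)
    have "inv\<^bsub>G\<^esub> a \<otimes>\<^bsub>G\<^esub> x = x \<otimes>\<^bsub>G\<^esub> inv\<^bsub>G\<^esub> a" if "x \<in> carrier G" for x
      using a(2)[OF that] a(1) that by (metis inv_closed inv_solve_left inv_solve_right m_assoc m_closed)
    with a(1) show "inv\<^bsub>G\<^esub> a \<in> ?Z" by (simp add: group_center_def)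
  next
    fix a b assume "a \<in> ?Z" "b \<in> ?Z"
    then have ab: "a \<in> carrier G" "\<And>x. x \<in> carrier G \<Longrightarrow> a \<otimes>\<^bsub>G\<^esub> x = x \<otimes>\<^bsub>G\<^esub> a"
      "b \<in> carrier G" "\<And>x. x \<in> carrier G \<Longrightarrow> b \<otimes>\<^bsub>G\<^esub> x = x \<otimes>\<^bsub>G\<^esub> b"
      by (auto simp: group_center_def)
    have "a \<otimes>\<^bsub>G\<^esub> b \<otimes>\<^bsub>G\<^esub> x = x \<otimes>\<^bsub>G\<^esub> (a \<otimes>\<^bsub>G\<^esub> b)" if x: "x \<in> carrier G" for x
    proof -
      have "a \<otimes>\<^bsub>G\<^esub> b \<otimes>\<^bsub>G\<^esub> x = a \<otimes>\<^bsub>G\<^esub> (b \<otimes>\<^bsub>G\<^esub> x)" using ab(1,3) x by (rule m_assoc)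
      also have "\<dots> = a \<otimes>\<^bsub>G\<^esub> (x \<otimes>\<^bsub>G\<^esub> b)" by (simp only: ab(4)[OF x])
      also have "\<dots> = a \<otimes>\<^bsub>G\<^esub> x \<otimes>\<^bsub>G\<^esub> b" using ab(1) x ab(3) by (rule m_assoc[symmetric])
      also have "\<dots> = x \<otimes>\<^bsub>G\<^esub> a \<otimes>\<^bsub>G\<^esub> b" by (simp only: ab(2)[OF x])
      also have "\<dots> = x \<otimes>\<^bsub>G\<^esub> (a \<otimes>\<^bsub>G\<^esub> b)" using x ab(1,3) by (rule m_assoc)
      finally show ?thesis .
    qed
    with ab(1,3) show "a \<otimes>\<^bsub>G\<^esub> b \<in> ?Z" by (simp add: group_center_def)
  qed (auto simp: group_center_def)
  have normal: "?Z \<lhd> G"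
  proof (rule normalI[OF sub], intro ballI)
    fix x assume "x \<in> carrier G"
    then show "?Z #>\<^bsub>G\<^esub> x = x <#\<^bsub>G\<^esub> ?Z"
      unfolding r_coset_def l_coset_def by (auto simp: group_center_def)
  qed
  interpret Z: normal ?Z G by (rule normal)
  have one: "\<one>\<^bsub>G\<^esub> \<in> ?Z" using sub by (rule subgroup.one_closed)
  have "card (?Z - {\<one>\<^bsub>G\<^esub>}) = 1" using assms one by (simp add: extra_special_def card_Diff_singleton)
  then obtain z where "?Z - {\<one>\<^bsub>G\<^esub>} = {z}" by (rule card_1_singletonE)
  then have z: "?Z = {\<one>\<^bsub>G\<^esub>, z}" "z \<noteq> \<one>\<^bsub>G\<^esub>"
    using insert_Diff[OF one] by blast+
  have elem: "elementary_abelian 2 (G Mod ?Z)" using assms by (simp add: extra_special_def)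
  have cosets: "a \<in> carrier G \<Longrightarrow> ?Z #>\<^bsub>G\<^esub> a \<in> carrier (G Mod ?Z)" for a
    by (auto simp: FactGroup_def RCOSETS_def)
  have mult: "(?Z #>\<^bsub>G\<^esub> a) \<otimes>\<^bsub>G Mod ?Z\<^esub> (?Z #>\<^bsub>G\<^esub> b) = ?Z #>\<^bsub>G\<^esub> (a \<otimes>\<^bsub>G\<^esub> b)"
    if "a \<in> carrier G" "b \<in> carrier G" for a b
    using that by (simp add: FactGroup_def Z.rcos_sum)
  have oneM: "\<one>\<^bsub>G Mod ?Z\<^esub> = ?Z" by (simp add: FactGroup_def)
  show ?thesis
  proof (intro exI[of _ z] extraspecial_two_group.intro extraspecial_two_group_axioms.intro)
    show "group G" by (rule is_group)
    show "finite (carrier G)" using assms by (simp add: extra_special_def)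
    show "group_center G = {\<one>\<^bsub>G\<^esub>, z}" "z \<noteq> \<one>\<^bsub>G\<^esub>" by fact+
  next
    fix x y assume xy: "x \<in> carrier G" "y \<in> carrier G"
    have "(?Z #>\<^bsub>G\<^esub> x) \<otimes>\<^bsub>G Mod ?Z\<^esub> (?Z #>\<^bsub>G\<^esub> y) = (?Z #>\<^bsub>G\<^esub> y) \<otimes>\<^bsub>G Mod ?Z\<^esub> (?Z #>\<^bsub>G\<^esub> x)"
      using elem cosets[OF xy(1)] cosets[OF xy(2)]
      by (intro comm_groupE(4)) (simp_all add: elementary_abelian_def)
    then have "?Z #>\<^bsub>G\<^esub> (x \<otimes>\<^bsub>G\<^esub> y) = ?Z #>\<^bsub>G\<^esub> (y \<otimes>\<^bsub>G\<^esub> x)" using xy by (simp only: mult)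
    moreover have "x \<otimes>\<^bsub>G\<^esub> y \<in> ?Z #>\<^bsub>G\<^esub> (x \<otimes>\<^bsub>G\<^esub> y)" using xy sub by (simp add: rcos_self)
    ultimately have "x \<otimes>\<^bsub>G\<^esub> y \<in> {\<one>\<^bsub>G\<^esub>, z} #>\<^bsub>G\<^esub> (y \<otimes>\<^bsub>G\<^esub> x)" using z(1) by simp
    then show "x \<otimes>\<^bsub>G\<^esub> y = y \<otimes>\<^bsub>G\<^esub> x \<or> x \<otimes>\<^bsub>G\<^esub> y = z \<otimes>\<^bsub>G\<^esub> (y \<otimes>\<^bsub>G\<^esub> x)"
      using xy by (auto simp: r_coset_def)
  next
    fix x assume x: "x \<in> carrier G"
    interpret M: group "G Mod ?Z" by (rule Z.factorgroup_is_group)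
    have "(?Z #>\<^bsub>G\<^esub> x) [^]\<^bsub>G Mod ?Z\<^esub> (2::nat) = ?Z"
      using elem cosets[OF x] by (simp add: elementary_abelian_def oneM)
    moreover have "(?Z #>\<^bsub>G\<^esub> x) [^]\<^bsub>G Mod ?Z\<^esub> (2::nat) =
        (?Z #>\<^bsub>G\<^esub> x) \<otimes>\<^bsub>G Mod ?Z\<^esub> (?Z #>\<^bsub>G\<^esub> x)"
      using cosets[OF x] by (simp only: numeral_2_eq_2 M.nat_pow_Suc M.nat_pow_0 M.l_one)
    ultimately have "?Z #>\<^bsub>G\<^esub> (x \<otimes>\<^bsub>G\<^esub> x) = ?Z"
      using mult[OF x x] by simp
    then have "x \<otimes>\<^bsub>G\<^esub> x \<in> ?Z"
      using rcos_self[of "x \<otimes>\<^bsub>G\<^esub> x" ?Z] x sub by simp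
    then show "x \<otimes>\<^bsub>G\<^esub> x = \<one>\<^bsub>G\<^esub> \<or> x \<otimes>\<^bsub>G\<^esub> x = z" using z(1) by simp
  qed
qed

context extraspecial_two_group
begin

text \<open>Arf's normal form of \<open>q\<close>: the bit \<open>e\<close> is the Arf invariant, and only the last pair sees it. With
  \<open>e = 0\<close> and \<open>e = 1\<close> these are the squares of the standard generators of the two presented groups.\<close>

definition normal_family :: "bit \<Rightarrow> nat \<Rightarrow> (nat \<Rightarrow> 'a) \<Rightarrow> (nat \<Rightarrow> 'a) \<Rightarrow> bool" where
  "normal_family e g X Y \<longleftrightarrow> symplectic_family g X Y \<and>
     (\<forall>i<g. sq_form (X i) = (if Suc i = g then e else 0) \<and> sq_form (Y i) = (if Suc i = g then e else 0))"

text \<open>The step of Arf's classification. A noncentral \<open>u\<close> with \<open>q(u) = 0\<close> has a partner \<open>w\<close>, and \<open>w\<close> or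
  \<open>wu\<close> is singular too. If no such \<open>u\<close> exists, any noncommuting pair \<open>u, v\<close> has \<open>q(u) = q(v) = 1\<close>, and
  nothing noncentral can be orthogonal to it: for such a \<open>t\<close> the element \<open>tu\<close> would be noncentral with
  \<open>q(tu) = 1 + 1 + 0 = 0\<close>. An anisotropic pair therefore occurs only as the last one.\<close>

lemma hyperbolic_or_anisotropic_pair:
  assumes F: "symplectic_family k X Y" and ne: "family_centralizer k X Y \<noteq> {\<one>, z}"
  obtains u v e where "u \<in> family_centralizer k X Y" "v \<in> family_centralizer k X Y"
    "comm_form u v = 1" "sq_form u = e" "sq_form v = e"
    "e = 1 \<Longrightarrow> perp (family_centralizer k X Y) u v = {\<one>, z}"
proof -
  let ?C = "family_centralizer k X Y"
  have C: "subgroup ?C G" using F by (rule subgroup_family_centralizer)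
  have in_G: "x \<in> carrier G" if "x \<in> ?C" for x using that by (simp add: family_centralizer_def)
  show ?thesis
  proof (cases "\<exists>u\<in>?C - {\<one>, z}. sq_form u = 0")
    case True
    then obtain u where u: "u \<in> ?C" "u \<notin> {\<one>, z}" "sq_form u = 0" by blast
    obtain w where w: "w \<in> ?C" "comm_form u w = 1"
      using family_centralizer_nondegenerate[OF F u(1,2)] .
    show ?thesis
    proof (cases "sq_form w = 0")
      case True
      then show ?thesis using u w by (intro that[of u w 0]) auto
    next
      case False
      then have "sq_form w = 1" by simp
      then have "sq_form (w \<otimes> u) = 0"
        using u w in_G comm_form_sym[of w u] by (simp add: sq_form_mult)
      moreover have "comm_form u (w \<otimes> u) = 1"
        using u w in_G by (simp add: comm_form_mult_right)
      moreover have "w \<otimes> u \<in> ?C" using u w C by (simp add: subgroup.m_closed)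
      ultimately show ?thesis using u by (intro that[of u "w \<otimes> u" 0]) auto
    qed
  next
    case False
    then have aniso: "sq_form x = 1" if "x \<in> ?C" "x \<notin> {\<one>, z}" for x using that by auto
    obtain u where u: "u \<in> ?C" "u \<notin> {\<one>, z}"
      using ne center_subset_family_centralizer[OF F] by auto
    obtain v where v: "v \<in> ?C" "comm_form u v = 1"
      using family_centralizer_nondegenerate[OF F u] .
    have "v \<notin> {\<one>, z}" using v u in_G by auto
    have "t \<in> {\<one>, z}" if t: "t \<in> perp ?C u v" for t
    proof (rule ccontr)
      assume "t \<notin> {\<one>, z}"
      then have t': "t \<in> ?C" "sq_form t = 1" "comm_form t u = 0" "comm_form t v = 0"
        using t aniso by (auto simp: perp_def)
      have "sq_form (t \<otimes> u) = 0"
        using t' u aniso in_G by (simp add: sq_form_mult)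
      moreover have "t \<otimes> u \<in> ?C" using t' u C by (simp add: subgroup.m_closed)
      moreover have "comm_form (t \<otimes> u) v = 1"
        using t' u v in_G by (simp add: comm_form_mult_left)
      then have "t \<otimes> u \<notin> {\<one>, z}"
        using comm_form_one(1) comm_form_z(1) in_G[OF v(1)] by fastforce
      ultimately show False using aniso by auto
    qed
    moreover have "{\<one>, z} \<subseteq> perp ?C u v"
      using center_subset_family_centralizer[OF F] u v in_G by (auto simp: perp_def)
    ultimately show ?thesis
      using u v aniso \<open>v \<notin> {\<one>, z}\<close> by (intro that[of u v 1]) auto
  qed
qed

lemma family_centralizer_upd:
  "family_centralizer k (X(k := u)) (Y(k := v)) = family_centralizer k X Y"
  by (auto simp: family_centralizer_def)

lemma symplectic_family_upd:
  "symplectic_family k (X(k := u)) (Y(k := v)) \<longleftrightarrow> symplectic_family k X Y"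
  by (auto simp: symplectic_family_def Pi_iff)

text \<open>Hyperbolic pairs are split off as long as possible. An anisotropic pair exhausts the group, so the
  order of \<open>G\<close> shows that it is the pair with number \<open>g\<close>.\<close>

lemma normal_family_exists:
  assumes card: "card (carrier G) = 2 ^ (2 * g + 1)"
  shows "\<exists>e X Y. normal_family e g X Y"
proof (rule ccontr)
  assume contra: "\<not> ?thesis"
  have card': "card (carrier G) = 4 ^ g * 2" using card by (simp add: power_mult)
  have "\<exists>X Y. symplectic_family k X Y \<and> (\<forall>i<k. sq_form (X i) = 0 \<and> sq_form (Y i) = 0)"
    if "k \<le> g" for k
    using that
  proof (induction k)
    case 0
    show ?case by (simp add: symplectic_family_def)
  next
    case (Suc k)
    then obtain X Y where XY: "symplectic_family k X Y"
        "\<And>i. i < k \<Longrightarrow> sq_form (X i) = 0" "\<And>i. i < k \<Longrightarrow> sq_form (Y i) = 0" by auto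
    have "family_centralizer k X Y \<noteq> {\<one>, z}"
    proof
      assume "family_centralizer k X Y = {\<one>, z}"
      then have "(4::nat) ^ g = 4 ^ k"
        using card_family_centralizer[OF XY(1)] card' card_center by simp
      then show False using Suc.prems by simp
    qed
    then obtain u v e where uv: "u \<in> family_centralizer k X Y" "v \<in> family_centralizer k X Y"
      "comm_form u v = 1" "sq_form u = e" "sq_form v = e"
      "e = 1 \<Longrightarrow> perp (family_centralizer k X Y) u v = {\<one>, z}"
      using hyperbolic_or_anisotropic_pair[OF XY(1)] by blast
    let ?X = "X(k := u)" and ?Y = "Y(k := v)"
    have F: "symplectic_family (Suc k) ?X ?Y"
      using XY uv by (simp add: symplectic_family_Suc symplectic_family_upd family_centralizer_upd)
    have "e = 0"
    proof (rule ccontr)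
      assume "e \<noteq> 0"
      then have e: "e = 1" by simp
      then have "family_centralizer (Suc k) ?X ?Y = {\<one>, z}"
        using uv by (simp add: family_centralizer_Suc family_centralizer_upd)
      then have "(4::nat) ^ g = 4 ^ Suc k"
        using card_family_centralizer[OF F] card' card_center by (simp del: power_Suc)
      then have "g = Suc k" by (simp del: power_Suc)
      then have "normal_family 1 g ?X ?Y"
        using F XY uv e by (auto simp: normal_family_def)
      then show False using contra by blast
    qed
    show ?case
    proof (intro exI conjI)
      show "symplectic_family (Suc k) ?X ?Y" by (rule F)
      show "\<forall>i<Suc k. sq_form (?X i) = 0 \<and> sq_form (?Y i) = 0"
        using XY uv \<open>e = 0\<close> by auto
    qed
  qed
  from this[of g] obtain X Y where "symplectic_family g X Y"
    "\<forall>i<g. sq_form (X i) = 0 \<and> sq_form (Y i) = 0" by auto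
  then have "normal_family 0 g X Y" by (simp add: normal_family_def)
  then show False using contra by blast
qed

text \<open>Each pair divides the order of the centralizer by four, so \<open>g\<close> pairs leave only two elements.\<close>

lemma family_centralizer_maximal:
  assumes card: "card (carrier G) = 2 ^ (2 * g + 1)" and F: "symplectic_family g X Y"
  shows "family_centralizer g X Y = {\<one>, z}"
proof -
  have "(4::nat) ^ g * 2 = 4 ^ g * card (family_centralizer g X Y)"
    using card_family_centralizer[OF F] card by (simp add: power_mult)
  then have "card (family_centralizer g X Y) = card {\<one>, z}" by (simp add: card_center)
  moreover have "finite (family_centralizer g X Y)"
    using finite_carrier by (simp add: family_centralizer_def)
  ultimately show ?thesis
    using center_subset_family_centralizer[OF F] card_subset_eq by metis
qed

text \<open>The first \<open>g - 1\<close> pairs contribute the factor \<open>2\<close> to the signed sum, the last one contributes \<open>2\<close> or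
  \<open>-2\<close>, and the center contributes \<open>2\<close>; hence the signed sum over \<open>G\<close> is \<open>2\<^bsup>g+1\<^esup>\<close> or its negative.\<close>

lemma card_sq_form_1_normal_family:
  assumes card: "card (carrier G) = 2 ^ (2 * g + 1)" and F: "normal_family e g X Y" and "g \<ge> 1"
  shows "card {x \<in> carrier G. sq_form x = 1} =
    2 * (if e = 0 then 2 ^ (2 * g - 1) - 2 ^ (g - 1) else 2 ^ (2 * g - 1) + 2 ^ (g - 1))"
proof -
  obtain k where k: "g = Suc k" using \<open>g \<ge> 1\<close> by (cases g) auto
  have S: "symplectic_family (Suc k) X Y" and q: "sq_form (X k) = e" "sq_form (Y k) = e"
    and q0: "\<And>i. i < k \<Longrightarrow> sq_form (X i) = 0" "\<And>i. i < k \<Longrightarrow> sq_form (Y i) = 0"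
    using F k by (auto simp: normal_family_def)
  have "sq_signed_sum (family_centralizer k X Y) = (if e = 0 then 2 else - 2) * 2"
    using sq_signed_sum_split[OF symplectic_family_pair[OF S lessI] q]
      family_centralizer_maximal[of g X Y] card S k
    by (simp add: sq_signed_sum_center flip: family_centralizer_Suc)
  then have "sq_signed_sum (carrier G) = 2 ^ k * ((if e = 0 then 2 else - 2) * 2)"
    using sq_signed_sum_carrier[of k X Y] S q0 by (simp add: symplectic_family_Suc)
  then have eq: "2 * int (card {x \<in> carrier G. sq_form x = 1}) =
      2 ^ (2 * k + 3) - 2 ^ k * ((if e = 0 then 2 else - 2) * 2)"
    using card_sq_form_1 card k by (simp add: eval_nat_numeral)
  have le: "(2::nat) ^ k \<le> 2 ^ (2 * k + 1)" by (intro power_increasing) auto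
  have "int (card {x \<in> carrier G. sq_form x = 1}) =
      int (2 * (if e = 0 then 2 ^ (2 * k + 1) - 2 ^ k else 2 ^ (2 * k + 1) + 2 ^ k))"
    using eq le by (simp add: of_nat_diff power_add split: if_splits)
  then show ?thesis unfolding of_nat_eq_iff by (simp add: k)
qed

section \<open>Symplectic families and symplectic matrices\<close>

text \<open>The coefficient of \<open>X j\<close> in \<open>x\<close> is \<open>c(x, Y j)\<close>, and that of \<open>Y j\<close> is \<open>c(x, X j)\<close>. The \<open>X\<close>-coordinates
  come first, in accordance with the block form of the standard symplectic matrix.\<close>

definition coordinate ::
    "nat \<Rightarrow> (nat \<Rightarrow> 'a) \<Rightarrow> (nat \<Rightarrow> 'a) \<Rightarrow> 'a \<Rightarrow> nat \<Rightarrow> bit" where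
  "coordinate g X Y x =
     (\<lambda>j\<in>{..<2 * g}. if j < g then comm_form x (Y j) else comm_form x (X (j - g)))"

lemma card_UNIV_bit: "card (UNIV :: bit set) = 2" "finite (UNIV :: bit set)"
proof -
  have "(UNIV :: bit set) = {0, 1}" by auto
  then show "card (UNIV :: bit set) = 2" "finite (UNIV :: bit set)"
    by (metis card_2_iff zero_neq_one, metis finite.emptyI finite_insert)
qed

text \<open>Two elements with equal coordinates differ by a central element, so no fibre has more than two
  elements. There are \<open>2\<^bsup>2g\<^esup>\<close> vectors for \<open>2\<^bsup>2g+1\<^esup>\<close> elements, so every fibre attains this bound.\<close>

lemma card_coordinate_fibre:
  assumes card: "card (carrier G) = 2 ^ (2 * g + 1)" and F: "symplectic_family g X Y"
    and v: "v \<in> {..<2 * g} \<rightarrow>\<^sub>E UNIV"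
  shows "card {x \<in> carrier G. coordinate g X Y x = v} = 2"
proof -
  let ?V = "{..<2 * g} \<rightarrow>\<^sub>E (UNIV :: bit set)"
  let ?fib = "\<lambda>v. {x \<in> carrier G. coordinate g X Y x = v}"
  note XY = symplectic_family_closed[OF F]
  have coord_V: "coordinate g X Y x \<in> ?V" for x
    by (rule PiE_I) (auto simp: coordinate_def)
  have finV: "finite ?V" using card_UNIV_bit by (intro finite_PiE) auto
  have le: "card (?fib v) \<le> 2" for v
  proof (cases "?fib v = {}")
    case False
    then obtain x where x: "x \<in> carrier G" "coordinate g X Y x = v" by blast
    have "y \<in> {x, z \<otimes> x}" if y: "y \<in> carrier G" "coordinate g X Y y = v" for y
    proof -
      have eq: "coordinate g X Y y j = coordinate g X Y x j" for j using x y by simp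
      have "comm_form y (Y i) = comm_form x (Y i) \<and> comm_form y (X i) = comm_form x (X i)"
        if "i < g" for i
        using eq[of i] eq[of "g + i"] that by (simp add: coordinate_def)
      then have "y \<otimes> inv x \<in> family_centralizer g X Y"
        using x y XY by (simp add: family_centralizer_def comm_form_mult_left)
      then have "y \<otimes> inv x \<in> {\<one>, z}" using family_centralizer_maximal[OF card F] by simp
      moreover have "y = (y \<otimes> inv x) \<otimes> x" using x y by (simp add: m_assoc)
      ultimately show ?thesis using x by auto
    qed
    then have "?fib v \<subseteq> {x, z \<otimes> x}" by blast
    then have "card (?fib v) \<le> card {x, z \<otimes> x}" by (intro card_mono) auto
    also have "\<dots> \<le> 2" by (simp add: card_insert_if)
    finally show ?thesis .
  next
    case True
    show ?thesis unfolding True by simp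
  qed
  have "(\<Sum>v\<in>?V. card (?fib v)) = (\<Sum>v\<in>?V. \<Sum>x\<in>{x \<in> carrier G. coordinate g X Y x = v}. 1)"
    by simp
  also have "\<dots> = (\<Sum>x\<in>carrier G. 1)"
    using finite_carrier finV image_subsetI[OF coord_V] by (rule sum.group)
  also have "\<dots> = (\<Sum>v\<in>?V. 2)"
    using card by (simp add: card_PiE card_UNIV_bit)
  finally have total: "(\<Sum>v\<in>?V. card (?fib v)) = (\<Sum>v\<in>?V. 2)" .
  show ?thesis
    using sum_mono_inv[OF total _ v finV] le by simp
qed

text \<open>For fixed \<open>y\<close> both sides are additive in \<open>x\<close>, so it suffices to compare them on the generators
  \<open>X i\<close>, \<open>Y i\<close> and \<open>z\<close>.\<close>

lemma comm_form_coordinates: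
  assumes card: "card (carrier G) = 2 ^ (2 * g + 1)" and g: "g \<ge> 1"
    and F: "symplectic_family g X Y" and x: "x \<in> carrier G" and y: "y \<in> carrier G"
  shows "comm_form x y = (\<Sum>k<g. coordinate g X Y x k * coordinate g X Y y (g + k)
    + coordinate g X Y x (g + k) * coordinate g X Y y k)"
proof -
  note XY = symplectic_family_closed[OF F]
  have rel: "comm_form (X i) (X j) = 0" "comm_form (Y i) (Y j) = 0"
    "comm_form (X i) (Y j) = of_bool (i = j)" "comm_form (Y j) (X i) = of_bool (i = j)"
    if "i < g" "j < g" for i j
    using F that comm_form_sym[of "Y j" "X i"] by (auto simp: symplectic_family_def)
  define s where "s x = (\<Sum>k<g. comm_form x (Y k) * comm_form y (X k)
    + comm_form x (X k) * comm_form y (Y k))" for x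
  define S where "S = {x \<in> carrier G. comm_form x y = s x}"
  have s_mult: "s (a \<otimes> b) = s a + s b" if "a \<in> carrier G" "b \<in> carrier G" for a b
    using that XY by (simp add: s_def comm_form_mult_left distrib_right flip: sum.distrib)
      (simp add: add_ac)
  have s_inv: "s (inv a) = s a" if "a \<in> carrier G" for a
    using that XY by (simp add: s_def)
  have s1: "s \<one> = 0" "s z = 0" using XY by (simp_all add: s_def)
  have "S = carrier G"
  proof (rule symplectic_family_generates[OF F family_centralizer_maximal[OF card F]])
    show "subgroup S G"
      using y s1 by (intro subgroupI) (auto simp: S_def s_mult s_inv comm_form_mult_left)
    show "z \<in> S" using y s1 by (simp add: S_def)
    have "s (X i) = (\<Sum>k<g. if k = i then comm_form y (X k) else 0)"
      "s (Y i) = (\<Sum>k<g. if k = i then comm_form y (Y k) else 0)" if "i < g" for i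
      unfolding s_def using that by (auto intro!: sum.cong simp: rel)
    then have "s (X i) = comm_form y (X i)" "s (Y i) = comm_form y (Y i)" if "i < g" for i
      using that by simp_all
    then show "X \<in> {..<g} \<rightarrow> S" "Y \<in> {..<g} \<rightarrow> S"
      using XY by (auto simp: S_def intro: comm_form_sym)
  qed
  then have "comm_form x y = s x" using x by (auto simp: S_def)
  also have "\<dots> = (\<Sum>k<g. coordinate g X Y x k * coordinate g X Y y (g + k)
    + coordinate g X Y x (g + k) * coordinate g X Y y k)"
    by (simp add: s_def coordinate_def)
  finally show ?thesis .
qed

end

lemma mat_transpose_J_mult_index:
  fixes M :: "bit mat"
  assumes M: "M \<in> carrier_mat (2 * g) (2 * g)" and "i < 2 * g" "j < 2 * g"
  shows "(transpose_mat M * symplectic_J g * M) $$ (i, j) =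
    (\<Sum>k<g. M $$ (k, i) * M $$ (g + k, j) + M $$ (g + k, i) * M $$ (k, j))"
proof -
  have J: "symplectic_J g \<in> carrier_mat (2 * g) (2 * g)"
    by (simp add: symplectic_J_def mult_2)
  have mult: "(A * B) $$ (k, l) = (\<Sum>m<n. A $$ (k, m) * B $$ (m, l))"
    if "A \<in> carrier_mat n n" "B \<in> carrier_mat n n" "k < n" "l < n" for A B :: "bit mat" and n k l
    using that by (simp add: scalar_prod_def lessThan_atLeast0)
  have split: "(\<Sum>l<m + n. f l) = (\<Sum>l<m. f l) + (\<Sum>l<n. f (m + l))"
    for m n and f :: "nat \<Rightarrow> bit"
    by (induction n) (simp_all add: add.assoc)
  have MJc: "transpose_mat M * symplectic_J g \<in> carrier_mat (2 * g) (2 * g)"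
    using M J by simp
  have Jk: "symplectic_J g $$ (k, l) = of_bool (l = g + k \<or> k = g + l)" if "k < 2 * g" "l < 2 * g" for k l
    using that by (auto simp: symplectic_J_def)
  have MJ: "(transpose_mat M * symplectic_J g) $$ (i, l) =
      (if l < g then M $$ (g + l, i) else M $$ (l - g, i))" if l: "l < 2 * g" for l
  proof -
    have "(transpose_mat M * symplectic_J g) $$ (i, l) =
        (\<Sum>k<2 * g. M $$ (k, i) * symplectic_J g $$ (k, l))"
      using M J assms l by (subst mult[of _ "2 * g"]) auto
    also have "\<dots> = (\<Sum>k<2 * g. if k = (if l < g then g + l else l - g) then M $$ (k, i) else 0)"
      using l by (intro sum.cong) (auto simp: Jk)
    also have "\<dots> = (if l < g then M $$ (g + l, i) else M $$ (l - g, i))"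
      using l by (subst sum.delta) auto
    finally show ?thesis .
  qed
  have "(transpose_mat M * symplectic_J g * M) $$ (i, j) =
      (\<Sum>l<2 * g. (transpose_mat M * symplectic_J g) $$ (i, l) * M $$ (l, j))"
    using MJc M assms(2,3) by (rule mult)
  also have "\<dots> = (\<Sum>l<2 * g. (if l < g then M $$ (g + l, i) else M $$ (l - g, i)) * M $$ (l, j))"
  proof (rule sum.cong)
    fix l assume "l \<in> {..<2 * g}"
    then show "(transpose_mat M * symplectic_J g) $$ (i, l) * M $$ (l, j) =
        (if l < g then M $$ (g + l, i) else M $$ (l - g, i)) * M $$ (l, j)"
      using MJ[of l] by simp
  qed simp
  also have "\<dots> = (\<Sum>l<g + g. (if l < g then M $$ (g + l, i) else M $$ (l - g, i)) * M $$ (l, j))"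
    by (simp only: mult_2)
  also have "\<dots> = (\<Sum>l<g. M $$ (g + l, i) * M $$ (l, j)) + (\<Sum>l<g. M $$ (l, i) * M $$ (g + l, j))"
    by (simp add: split add.commute)
  finally show ?thesis by (simp add: sum.distrib add.commute)
qed

context extraspecial_two_group
begin

text \<open>Writing the coordinates of a family into the columns of a matrix turns the symplectic relations into
  \<open>M\<^sup>T J M = J\<close>. Each of the \<open>2g\<close> columns can be lifted to \<open>G\<close> in two ways.\<close>

lemma card_symplectic_families:
  assumes card: "card (carrier G) = 2 ^ (2 * g + 1)" and g: "g \<ge> 1"
  shows "card {F \<in> {..<2 * g} \<rightarrow>\<^sub>E carrier G. symplectic_family g F (\<lambda>i. F (g + i))} =
    2 ^ (2 * g) * card (Sp_F2 g)" (is "card ?S = _")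
proof -
  obtain X Y where XY: "symplectic_family g X Y"
    using normal_family_exists[OF card] by (auto simp: normal_family_def)
  let ?c = "coordinate g X Y"
  define mat_of where "mat_of F = mat (2 * g) (2 * g) (\<lambda>(i, j). ?c (F j) i)" for F
  have J: "symplectic_J g \<in> carrier_mat (2 * g) (2 * g)"
    by (simp add: symplectic_J_def mult_2)
  have Sp_iff: "mat_of F \<in> Sp_F2 g \<longleftrightarrow> symplectic_family g F (\<lambda>i. F (g + i))"
    if F: "F \<in> {..<2 * g} \<rightarrow> carrier G" for F
  proof -
    have FG: "F i \<in> carrier G" if "i < 2 * g" for i using F that by auto
    have car: "mat_of F \<in> carrier_mat (2 * g) (2 * g)" by (simp add: mat_of_def)
    define T where "T = transpose_mat (mat_of F) * symplectic_J g * mat_of F"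
    have Tcar: "T \<in> carrier_mat (2 * g) (2 * g)" using car J by (simp add: T_def)
    have ij: "T $$ (i, j) = comm_form (F i) (F j)"
      if "i < 2 * g" "j < 2 * g" for i j
      using that mat_transpose_J_mult_index[OF car that]
        comm_form_coordinates[OF card g XY FG FG, OF that]
      by (simp add: T_def) (simp add: mat_of_def)
    have Jk: "symplectic_J g $$ (k, l) = of_bool (l = g + k \<or> k = g + l)"
      if "k < 2 * g" "l < 2 * g" for k l
      using that by (auto simp: symplectic_J_def)
    have "mat_of F \<in> Sp_F2 g \<longleftrightarrow> T = symplectic_J g"
      using car by (simp add: Sp_F2_def T_def)
    also have "\<dots> \<longleftrightarrow> (\<forall>i<2 * g. \<forall>j<2 * g.
        comm_form (F i) (F j) = of_bool (j = g + i \<or> i = g + j))"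
      using Tcar J by (auto simp: mat_eq_iff ij Jk)
    also have "\<dots> \<longleftrightarrow> symplectic_family g F (\<lambda>i. F (g + i))"
    proof
      assume L: "\<forall>i<2 * g. \<forall>j<2 * g. comm_form (F i) (F j) = of_bool (j = g + i \<or> i = g + j)"
      then show "symplectic_family g F (\<lambda>i. F (g + i))"
        using FG by (auto simp: symplectic_family_def)
    next
      assume R: "symplectic_family g F (\<lambda>i. F (g + i))"
      show "\<forall>i<2 * g. \<forall>j<2 * g. comm_form (F i) (F j) = of_bool (j = g + i \<or> i = g + j)"
      proof (intro allI impI)
        fix i j assume ij: "i < 2 * g" "j < 2 * g"
        obtain i' where i: "i' < g" "i = i' \<or> i = g + i'"
          using ij(1) that by (metis add_diff_inverse_nat mult_2 nat_add_left_cancel_less)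
        obtain j' where j: "j' < g" "j = j' \<or> j = g + j'"
          using ij(2) that by (metis add_diff_inverse_nat mult_2 nat_add_left_cancel_less)
        show "comm_form (F i) (F j) = of_bool (j = g + i \<or> i = g + j)"
          using R i j comm_form_sym[of "F (g + i')" "F j'"]
          by (auto simp: symplectic_family_def)
      qed
    qed
    finally show ?thesis .
  qed
  have fibre: "card {F \<in> ?S. mat_of F = M} = 2 ^ (2 * g)" if M: "M \<in> Sp_F2 g" for M
  proof -
    have car: "M \<in> carrier_mat (2 * g) (2 * g)" using M by (simp add: Sp_F2_def)
    let ?col = "\<lambda>j. \<lambda>i\<in>{..<2 * g}. M $$ (i, j)"
    have mat_eq: "mat_of F = M \<longleftrightarrow> (\<forall>j<2 * g. ?c (F j) = ?col j)" for F
    proof -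
      have "mat_of F = M \<longleftrightarrow> (\<forall>j<2 * g. \<forall>i<2 * g. ?c (F j) i = M $$ (i, j))"
        using car by (auto simp: mat_eq_iff mat_of_def)
      also have "\<dots> \<longleftrightarrow> (\<forall>j<2 * g. ?c (F j) = ?col j)"
        by (auto simp: fun_eq_iff coordinate_def restrict_def)
      finally show ?thesis .
    qed
    have "{F \<in> ?S. mat_of F = M} =
        PiE {..<2 * g} (\<lambda>j. {x \<in> carrier G. ?c x = ?col j})" (is "_ = ?P")
    proof (intro equalityI subsetI)
      fix F assume "F \<in> {F \<in> ?S. mat_of F = M}"
      then have "F \<in> {..<2 * g} \<rightarrow>\<^sub>E carrier G" "\<forall>j<2 * g. ?c (F j) = ?col j"
        unfolding mat_eq by auto
      then show "F \<in> ?P" by (auto simp: PiE_iff)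
    next
      fix F assume F: "F \<in> ?P"
      then have FG: "F \<in> {..<2 * g} \<rightarrow>\<^sub>E carrier G" by (auto simp: PiE_iff)
      moreover have "mat_of F = M" using F unfolding mat_eq by (auto simp: PiE_iff)
      ultimately show "F \<in> {F \<in> ?S. mat_of F = M}"
        using Sp_iff[of F] M by (auto simp: PiE_def)
    qed
    then have "card {F \<in> ?S. mat_of F = M} =
        (\<Prod>j<2 * g. card {x \<in> carrier G. ?c x = ?col j})"
      by (simp add: card_PiE)
    also have "\<dots> = (\<Prod>j<2 * g. 2)"
      by (intro prod.cong refl card_coordinate_fibre[OF card XY]) auto
    finally show ?thesis by simp
  qed
  have finS: "finite ?S"
    using finite_carrier by (intro finite_subset[OF _ finite_PiE[of "{..<2 * g}" "\<lambda>_. carrier G"]]) auto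
  have img: "mat_of ` ?S = Sp_F2 g"
  proof (intro equalityI subsetI)
    fix M assume "M \<in> mat_of ` ?S"
    then show "M \<in> Sp_F2 g" using Sp_iff by (auto simp: PiE_def)
  next
    fix M assume "M \<in> Sp_F2 g"
    then have "card {F \<in> ?S. mat_of F = M} \<noteq> 0" by (simp only: fibre) simp
    then have "{F \<in> ?S. mat_of F = M} \<noteq> {}" by (metis card.empty)
    then show "M \<in> mat_of ` ?S" by blast
  qed
  have "card ?S = (\<Sum>F\<in>?S. 1 :: nat)" by simp
  also have "\<dots> = (\<Sum>M\<in>mat_of ` ?S. \<Sum>F\<in>{F \<in> ?S. mat_of F = M}. 1 :: nat)"
    using finS by (intro sum.group[symmetric]) auto
  also have "\<dots> = (\<Sum>M\<in>Sp_F2 g. 2 ^ (2 * g))"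
    unfolding img
  proof (rule sum.cong)
    fix M assume "M \<in> Sp_F2 g"
    from fibre[OF this] show "(\<Sum>F\<in>{F \<in> ?S. mat_of F = M}. 1 :: nat) = 2 ^ (2 * g)"
      by (simp only: card_eq_sum)
  qed simp
  finally show ?thesis by simp
qed

end


section \<open>The two presented extra-special groups\<close>

text \<open>The bit \<open>e\<close> is the Arf invariant of the squaring form, as in the normal families above; it allows
  the two groups to be treated together.\<close>

definition es_rels :: "bit \<Rightarrow> nat \<Rightarrow> (es_gen word \<times> es_gen word) set" where
  "es_rels e g = (if e = 0 then H_rels g else G_rels g)"

definition es_group :: "bit \<Rightarrow> nat \<Rightarrow> es_gen word set monoid" where
  "es_group e g = presented_group (es_gens g) (es_rels e g)"

lemma es_group_simps: "es_group 0 g = H_group g" "es_group 1 g = G_group g"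
  by (simp_all add: es_group_def es_rels_def H_group_def G_group_def)

context group
begin

definition commutator :: "'a \<Rightarrow> 'a \<Rightarrow> 'a" where
  "commutator x y = x \<otimes> y \<otimes> inv x \<otimes> inv y"

lemma mult_eq_commutator:
  "\<lbrakk>x \<in> carrier G; y \<in> carrier G\<rbrakk> \<Longrightarrow> x \<otimes> y = commutator x y \<otimes> (y \<otimes> x)"
  by (simp add: commutator_def m_assoc inv_mult_group flip: m_assoc[of "inv y" y x])

lemma commutator_eq_one_iff:
  "\<lbrakk>x \<in> carrier G; y \<in> carrier G\<rbrakk> \<Longrightarrow> commutator x y = \<one> \<longleftrightarrow> x \<otimes> y = y \<otimes> x"
  using mult_eq_commutator[of x y] r_cancel_one'[of "y \<otimes> x" "commutator x y"]
  by (auto simp: commutator_def)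

lemma satisfies_es_rels_iff:
  assumes f: "f \<in> es_gens g \<rightarrow> carrier G" and g: "g \<ge> 1"
  shows "satisfies_rels G (es_gens g) (es_rels e g) f \<longleftrightarrow>
    f ESZ \<otimes> f ESZ = \<one> \<and>
    (\<forall>i\<in>{1..g}. commutator (f (ESX i)) (f ESZ) = \<one> \<and> commutator (f (ESY i)) (f ESZ) = \<one> \<and>
       f (ESX i) \<otimes> f (ESX i) = (if e = 1 \<and> i = g then f ESZ else \<one>) \<and>
       f (ESY i) \<otimes> f (ESY i) = (if e = 1 \<and> i = g then f ESZ else \<one>)) \<and>
    (\<forall>i\<in>{1..g}. \<forall>j\<in>{1..g}. commutator (f (ESX i)) (f (ESX j)) = \<one> \<and>
       commutator (f (ESY i)) (f (ESY j)) = \<one> \<and>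
       commutator (f (ESX i)) (f (ESY j)) = (if i = j then inv (f ESZ) else \<one>))"
    (is "?L \<longleftrightarrow> ?R")
proof -
  let ?ev = "word_eval G f"
  define ok where "ok uv \<longleftrightarrow> ?ev (fst uv) = ?ev (snd uv)" for uv
  have gens: "ESX i \<in> es_gens g \<longleftrightarrow> i \<in> {1..g}" "ESY i \<in> es_gens g \<longleftrightarrow> i \<in> {1..g}" "ESZ \<in> es_gens g" for i
    by (auto simp: es_gens_def)
  have sq: "?ev (letter x @ letter x') = f x \<otimes> f x'" if "x \<in> es_gens g" "x' \<in> es_gens g" for x x'
    using that f by (simp add: word_eval_append[OF f] word_eval_letter[OF f])
  have cm: "?ev (wcomm (letter x) (letter y)) = commutator (f x) (f y)"
    if "x \<in> es_gens g" "y \<in> es_gens g" for x y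
    using that f by (simp add: word_eval_wcomm[OF f] word_eval_letter[OF f] commutator_def)
  have iv: "?ev (winv (letter ESZ)) = inv (f ESZ)"
    using gens by (simp add: word_eval_winv[OF f] word_eval_letter[OF f])
  have lt: "?ev (letter ESZ) = f ESZ"
    using gens by (simp add: word_eval_letter[OF f])
  have words: "\<forall>(u, v)\<in>es_rels e g. u \<in> words (es_gens g) \<and> v \<in> words (es_gens g)"
    using g by (auto simp: es_rels_def H_rels_def G_rels_def es_common_rels_def Let_def gens)
  have all_ok: "?L \<longleftrightarrow> (\<forall>uv\<in>es_rels e g. ok uv)"
    using words by (fastforce simp: satisfies_rels_def ok_def)
  have ball1: "(\<forall>uv\<in>{h i |i. P i}. ok uv) \<longleftrightarrow> (\<forall>i. P i \<longrightarrow> ok (h i))"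
    for h :: "nat \<Rightarrow> es_gen word \<times> es_gen word" and P by blast
  have ball2: "(\<forall>uv\<in>{h i j |i j. P i j}. ok uv) \<longleftrightarrow> (\<forall>i j. P i j \<longrightarrow> ok (h i j))"
    for h :: "nat \<Rightarrow> nat \<Rightarrow> es_gen word \<times> es_gen word" and P by blast
  have common: "(\<forall>uv\<in>es_common_rels g. ok uv) \<longleftrightarrow>
    f ESZ \<otimes> f ESZ = \<one> \<and>
    (\<forall>i\<in>{1..g}. commutator (f (ESX i)) (f ESZ) = \<one>) \<and>
    (\<forall>i\<in>{1..g}. commutator (f (ESY i)) (f ESZ) = \<one>) \<and>
    (\<forall>i\<in>{1..g}. \<forall>j\<in>{1..g}. commutator (f (ESX i)) (f (ESX j)) = \<one>) \<and>
    (\<forall>i\<in>{1..g}. \<forall>j\<in>{1..g}. commutator (f (ESY i)) (f (ESY j)) = \<one>) \<and>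
    (\<forall>i\<in>{1..g}. \<forall>j\<in>{1..g}. commutator (f (ESX i)) (f (ESY j)) = (if i = j then inv (f ESZ) else \<one>))"
    unfolding es_common_rels_def Let_def ball_Un ball1 ball2
    by (simp add: ok_def gens sq cm iv if_distrib[of ?ev] imp_conjL Ball_def
        cong: imp_cong if_cong del: atLeastAtMost_iff)
  show ?thesis
  proof (cases "e = 0")
    case True
    then have rels: "es_rels e g = H_rels g" by (simp add: es_rels_def)
    have "?L \<longleftrightarrow> (\<forall>uv\<in>es_common_rels g. ok uv) \<and>
      (\<forall>i\<in>{1..g}. f (ESX i) \<otimes> f (ESX i) = \<one>) \<and> (\<forall>i\<in>{1..g}. f (ESY i) \<otimes> f (ESY i) = \<one>)"
      unfolding all_ok unfolding rels H_rels_def ball_Un ball1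
      by (simp add: ok_def gens sq Ball_def conj_assoc cong: imp_cong del: atLeastAtMost_iff)
    then show ?thesis unfolding common using True by auto
  next
    case False
    then have e: "e = 1" by simp
    then have rels: "es_rels e g = G_rels g" by (simp add: es_rels_def)
    have L: "?L \<longleftrightarrow> (\<forall>uv\<in>es_common_rels g. ok uv) \<and>
      (\<forall>i\<in>{1..<g}. f (ESX i) \<otimes> f (ESX i) = \<one>) \<and> (\<forall>i\<in>{1..<g}. f (ESY i) \<otimes> f (ESY i) = \<one>) \<and>
      f (ESX g) \<otimes> f (ESX g) = f ESZ \<and> f (ESY g) \<otimes> f (ESY g) = f ESZ"
      unfolding all_ok unfolding rels G_rels_def ball_Un ball1 using g
      by (simp add: ok_def gens sq lt Ball_def conj_assoc ball1 cong: imp_cong) blast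
    have sqs: "(\<forall>i\<in>{1..g}. h i \<otimes> h i = (if e = 1 \<and> i = g then f ESZ else \<one>)) \<longleftrightarrow>
      (\<forall>i\<in>{1..<g}. h i \<otimes> h i = \<one>) \<and> h g \<otimes> h g = f ESZ" for h :: "nat \<Rightarrow> 'a"
    proof -
      have "{1..g} = insert g {1..<g}" using g by auto
      then show ?thesis using e by auto
    qed
    show ?thesis unfolding L common ball_conj_distrib sqs by blast
  qed
qed

text \<open>A normal form argument: the products \<open>z\<^bsup>a\<^esup> t\<^sub>0\<^bsup>b\<^esup> t\<^sub>1\<^bsup>c\<^esup> \<dots>\<close> with exponents \<open>0\<close> or \<open>1\<close> are closed under right
  multiplication by the generators, since moving a generator into its place costs only powers of \<open>z\<close>.\<close>

lemma card_le_generators: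
  fixes t :: "nat \<Rightarrow> 'a"
  assumes z: "z \<in> carrier G" "z \<otimes> z = \<one>"
    and t: "\<And>i. i < n \<Longrightarrow> t i \<in> carrier G" "\<And>i. i < n \<Longrightarrow> t i \<otimes> z = z \<otimes> t i"
    and sq: "\<And>i. i < n \<Longrightarrow> t i \<otimes> t i = \<one> \<or> t i \<otimes> t i = z"
    and comm: "\<And>i j. i < n \<Longrightarrow> j < n \<Longrightarrow> t i \<otimes> t j = t j \<otimes> t i \<or> t i \<otimes> t j = z \<otimes> (t j \<otimes> t i)"
    and gen: "\<And>U. subgroup U G \<Longrightarrow> z \<in> U \<Longrightarrow> (\<And>i. i < n \<Longrightarrow> t i \<in> U) \<Longrightarrow> U = carrier G"
  shows "finite (carrier G) \<and> card (carrier G) \<le> 2 ^ (n + 1)"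
proof -
  \<comment> \<open>\<open>P k\<close> is the set of ordered products of \<open>z\<close> and the first \<open>k\<close> generators.\<close>
  define P where "P = rec_nat {\<one>, z} (\<lambda>k A. A \<union> (\<lambda>s. s \<otimes> t k) ` A)"
  have P0: "P 0 = {\<one>, z}" and PS: "P (Suc k) = P k \<union> (\<lambda>s. s \<otimes> t k) ` P k" for k
    by (simp_all add: P_def)
  have fin: "finite (P k) \<and> card (P k) \<le> 2 ^ (k + 1)" for k
  proof (induction k)
    case 0
    show ?case by (simp add: P0 card_insert_if)
  next
    case (Suc k)
    have "card (P (Suc k)) \<le> card (P k) + card ((\<lambda>s. s \<otimes> t k) ` P k)"
      unfolding PS by (rule card_Un_le)
    also have "\<dots> \<le> card (P k) + card (P k)"
      using Suc by (simp add: card_image_le)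
    finally show ?case using Suc by (simp add: PS)
  qed
  have sub: "P k \<subseteq> carrier G" if "k \<le> n" for k
    using that by (induction k) (auto simp: P0 PS z t)
  have Pz: "s \<otimes> z \<in> P k" if "k \<le> n" "s \<in> P k" for k s
    using that
  proof (induction k arbitrary: s)
    case 0
    then show ?case using z by (auto simp: P0)
  next
    case (Suc k)
    from Suc.prems(2) consider "s \<in> P k" | r where "r \<in> P k" "s = r \<otimes> t k" by (auto simp: PS)
    then show ?case
    proof cases
      case 1
      then show ?thesis using Suc by (simp add: PS)
    next
      case 2
      have "r \<in> carrier G" using 2 sub[of k] Suc.prems by auto
      then have "s \<otimes> z = (r \<otimes> z) \<otimes> t k" using 2 z t Suc.prems by (simp add: m_assoc)
      moreover have "r \<otimes> z \<in> P k" using Suc 2 by simp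
      ultimately show ?thesis by (auto simp: PS)
    qed
  qed
  have Pt: "s \<otimes> t i \<in> P k" if "k \<le> n" "i < k" "s \<in> P k" for k s i
    using that
  proof (induction k arbitrary: s)
    case (Suc k)
    note [simp] = z t
    have k: "k < n" "k \<le> n" "i < n" using Suc.prems by auto
    from Suc.prems(3) consider "s \<in> P k" | r where "r \<in> P k" "s = r \<otimes> t k" by (auto simp: PS)
    then show ?case
    proof cases
      case 1
      then show ?thesis using Suc by (cases "i = k") (auto simp: PS)
    next
      case 2
      have r: "r \<in> carrier G" using 2 sub[OF k(2)] by auto
      show ?thesis
      proof (cases "i = k")
        case True
        have "s \<otimes> t i = r \<otimes> (t k \<otimes> t k)" using 2 True r k by (simp add: m_assoc)
        also have "\<dots> \<in> P k" using sq[OF k(1)] 2 r Pz[OF k(2)] by auto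
        finally show ?thesis by (simp add: PS)
      next
        case False
        then have ri: "r \<otimes> t i \<in> P k" using Suc 2 by auto
        have "s \<otimes> t i = r \<otimes> (t k \<otimes> t i)" using 2 r k by (simp add: m_assoc)
        also have "\<dots> = (r \<otimes> t i) \<otimes> t k \<or> \<dots> = (r \<otimes> t i \<otimes> z) \<otimes> t k"
        proof (cases "t k \<otimes> t i = t i \<otimes> t k")
          case True
          then show ?thesis using r k by (simp add: m_assoc)
        next
          case False
          then have "t k \<otimes> t i = z \<otimes> (t i \<otimes> t k)" using comm[of k i] k by blast
          also have "\<dots> = t i \<otimes> (z \<otimes> t k)"
            using k by (simp flip: m_assoc)
          finally show ?thesis using r k by (simp add: m_assoc del: t(2))
        qed
        finally show ?thesis using ri Pz[OF k(2) ri] by (auto simp: PS)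
      qed
    qed
  qed simp
  have Pinv: "s \<otimes> inv (t i) \<in> P n" if i: "i < n" and s: "s \<in> P n" for s i
  proof -
    have sG: "s \<in> carrier G" using s sub[of n] by auto
    have "inv (t i) = t i \<or> inv (t i) = t i \<otimes> z"
    proof (cases "t i \<otimes> t i = \<one>")
      case True
      then show ?thesis using i t inv_equality by simp
    next
      case False
      then have "(t i \<otimes> z) \<otimes> t i = \<one>"
        using sq[OF i] i z t by (metis m_assoc)
      then show ?thesis using i t z inv_equality[of "t i \<otimes> z" "t i"] by simp
    qed
    moreover have "s \<otimes> t i \<in> P n" using Pt[of n i s] i s by simp
    moreover have "s \<otimes> t i \<otimes> z \<in> P n" using Pt[of n i s] Pz i s by simp
    moreover have "s \<otimes> (t i \<otimes> z) = s \<otimes> t i \<otimes> z" using sG t(1)[OF i] z by (simp add: m_assoc)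
    ultimately show ?thesis by (elim disjE) (simp_all only:)
  qed
  \<comment> \<open>Closure under right multiplication defines a subgroup, to which the generation hypothesis applies.\<close>
  define U where "U = {y \<in> carrier G. \<forall>s\<in>P n. s \<otimes> y \<in> P n \<and> s \<otimes> inv y \<in> P n}"
  have "U = carrier G"
  proof (rule gen)
    have PG: "s \<in> carrier G" if "s \<in> P n" for s using that sub[of n] by auto
    show "subgroup U G"
    proof (rule subgroupI)
      show "U \<noteq> {}" using PG by (auto simp: U_def intro!: exI[of _ \<one>])
      fix a assume a: "a \<in> U"
      then show "inv a \<in> U" by (auto simp: U_def)
      fix b assume b: "b \<in> U"
      have "s \<otimes> (a \<otimes> b) = (s \<otimes> a) \<otimes> b" "s \<otimes> inv (a \<otimes> b) = (s \<otimes> inv b) \<otimes> inv a"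
        if "s \<in> P n" for s
        using that a b PG by (auto simp: U_def m_assoc inv_mult_group)
      then show "a \<otimes> b \<in> U" using a b by (auto simp: U_def)
    qed (auto simp: U_def)
    have "inv z = z" using z by (intro inv_equality)
    then show "z \<in> U" using z Pz by (auto simp: U_def)
    show "t i \<in> U" if "i < n" for i using that t Pt Pinv by (auto simp: U_def)
  qed
  moreover have one: "\<one> \<in> P n"
  proof -
    have "\<one> \<in> P k" for k by (induction k) (auto simp: P0 PS)
    then show ?thesis .
  qed
  ultimately have "carrier G \<subseteq> P n"
    unfolding U_def by (metis (no_types, lifting) l_one mem_Collect_eq subsetI)
  then show ?thesis using fin[of n] by (meson card_mono finite_subset order_trans)
qed

end

text \<open>By this bound every epimorphism onto a group of order \<open>2\<^bsup>2g+1\<^esup>\<close> is an isomorphism.\<close>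

lemma card_es_group_le:
  assumes g: "g \<ge> 1"
  shows "finite (carrier (es_group e g)) \<and> card (carrier (es_group e g)) \<le> 2 ^ (2 * g + 1)"
proof -
  let ?P = "es_group e g"
  interpret P: group ?P unfolding es_group_def by (rule group_presented_group)
  have idhom: "id \<in> hom ?P ?P" by (simp add: hom_def)
  define f where "f = (\<lambda>x. pres_class (es_gens g) (es_rels e g) (letter x))"
  have f: "f \<in> es_gens g \<rightarrow> carrier ?P" by (auto simp: f_def es_group_def presented_group_def)
  have "satisfies_rels ?P (es_gens g) (es_rels e g) f"
    using P.hom_satisfies_rels[of id "es_gens g" "es_rels e g"] idhom by (simp add: f_def es_group_def)
  note rels = this[unfolded P.satisfies_es_rels_iff[OF f g]]
  have gens: "f ESZ \<in> carrier ?P" "i \<in> {1..g} \<Longrightarrow> f (ESX i) \<in> carrier ?P"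
    "i \<in> {1..g} \<Longrightarrow> f (ESY i) \<in> carrier ?P" for i
    using f by (auto simp: es_gens_def)
  have invz: "inv\<^bsub>?P\<^esub> f ESZ = f ESZ"
    using rels gens by (intro P.inv_equality) auto
  define t where "t j = (if j < g then f (ESX (Suc j)) else f (ESY (Suc (j - g))))" for j
  have t: "t j \<in> carrier ?P" if "j < 2 * g" for j
    using that gens by (auto simp: t_def)
  have cases: "\<exists>i\<in>{1..g}. t j = f (ESX i) \<or> t j = f (ESY i)" if "j < 2 * g" for j
  proof (cases "j < g")
    case True
    then show ?thesis by (intro bexI[of _ "Suc j"]) (auto simp: t_def)
  next
    case False
    then show ?thesis using that by (intro bexI[of _ "Suc (j - g)"]) (auto simp: t_def)
  qed
  have swap: "b \<otimes>\<^bsub>?P\<^esub> a = f ESZ \<otimes>\<^bsub>?P\<^esub> (a \<otimes>\<^bsub>?P\<^esub> b)"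
    if "a \<otimes>\<^bsub>?P\<^esub> b = f ESZ \<otimes>\<^bsub>?P\<^esub> (b \<otimes>\<^bsub>?P\<^esub> a)" "a \<in> carrier ?P" "b \<in> carrier ?P" for a b
  proof -
    have "f ESZ \<otimes>\<^bsub>?P\<^esub> (a \<otimes>\<^bsub>?P\<^esub> b) = (f ESZ \<otimes>\<^bsub>?P\<^esub> f ESZ) \<otimes>\<^bsub>?P\<^esub> (b \<otimes>\<^bsub>?P\<^esub> a)"
      using that gens by (simp add: P.m_assoc)
    then show ?thesis using rels that by simp
  qed
  have XX: "f (ESX i) \<otimes>\<^bsub>?P\<^esub> f (ESX j) = f (ESX j) \<otimes>\<^bsub>?P\<^esub> f (ESX i)"
    and YY: "f (ESY i) \<otimes>\<^bsub>?P\<^esub> f (ESY j) = f (ESY j) \<otimes>\<^bsub>?P\<^esub> f (ESY i)"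
    and XY: "f (ESX i) \<otimes>\<^bsub>?P\<^esub> f (ESY j) = f (ESY j) \<otimes>\<^bsub>?P\<^esub> f (ESX i) \<or>
      f (ESX i) \<otimes>\<^bsub>?P\<^esub> f (ESY j) = f ESZ \<otimes>\<^bsub>?P\<^esub> (f (ESY j) \<otimes>\<^bsub>?P\<^esub> f (ESX i))"
    if ij: "i \<in> {1..g}" "j \<in> {1..g}" for i j
  proof -
    show "f (ESX i) \<otimes>\<^bsub>?P\<^esub> f (ESX j) = f (ESX j) \<otimes>\<^bsub>?P\<^esub> f (ESX i)"
      "f (ESY i) \<otimes>\<^bsub>?P\<^esub> f (ESY j) = f (ESY j) \<otimes>\<^bsub>?P\<^esub> f (ESY i)"
      using rels ij gens by (metis P.commutator_eq_one_iff)+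
    show "f (ESX i) \<otimes>\<^bsub>?P\<^esub> f (ESY j) = f (ESY j) \<otimes>\<^bsub>?P\<^esub> f (ESX i) \<or>
      f (ESX i) \<otimes>\<^bsub>?P\<^esub> f (ESY j) = f ESZ \<otimes>\<^bsub>?P\<^esub> (f (ESY j) \<otimes>\<^bsub>?P\<^esub> f (ESX i))"
      using rels ij gens(2)[OF ij(1)] gens(3)[OF ij(2)] P.mult_eq_commutator[OF gens(2)[OF ij(1)] gens(3)[OF ij(2)]]
      by (auto simp: invz)
  qed
  have YX: "f (ESY j) \<otimes>\<^bsub>?P\<^esub> f (ESX i) = f (ESX i) \<otimes>\<^bsub>?P\<^esub> f (ESY j) \<or>
      f (ESY j) \<otimes>\<^bsub>?P\<^esub> f (ESX i) = f ESZ \<otimes>\<^bsub>?P\<^esub> (f (ESX i) \<otimes>\<^bsub>?P\<^esub> f (ESY j))"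
    if ij: "i \<in> {1..g}" "j \<in> {1..g}" for i j
    using XY[OF ij] swap gens(2)[OF ij(1)] gens(3)[OF ij(2)] by metis
  have gen: "U = carrier ?P"
    if U: "subgroup U ?P" "f ESZ \<in> U" "\<And>j. j < 2 * g \<Longrightarrow> t j \<in> U" for U
  proof -
    have "f (ESX i) \<in> U \<and> f (ESY i) \<in> U" if i: "i \<in> {1..g}" for i
    proof -
      obtain k where "i = Suc k" "k < g" using i by (cases i) auto
      then show ?thesis using U(3)[of k] U(3)[of "g + k"] by (simp add: t_def)
    qed
    then have "\<forall>x\<in>es_gens g. f x \<in> U" using U(2) by (auto simp: es_gens_def)
    moreover have "id \<in> epi ?P ?P" using idhom by (simp add: epi_def)
    ultimately show ?thesis
      using P.epi_presented_group_iff[of id "es_gens g" "es_rels e g"] idhom U(1)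
      by (auto simp: es_group_def f_def)
  qed
  show ?thesis
  proof (rule P.card_le_generators[of "f ESZ" "2 * g" t])
    show "f ESZ \<in> carrier ?P" "f ESZ \<otimes>\<^bsub>?P\<^esub> f ESZ = \<one>\<^bsub>?P\<^esub>" using gens rels by auto
  next
    fix j assume j: "j < 2 * g"
    show "t j \<in> carrier ?P" using j by (rule t)
    obtain i where i: "i \<in> {1..g}" "t j = f (ESX i) \<or> t j = f (ESY i)" using cases[OF j] by blast
    have "P.commutator (t j) (f ESZ) = \<one>\<^bsub>?P\<^esub>" using rels i by auto
    then show "t j \<otimes>\<^bsub>?P\<^esub> f ESZ = f ESZ \<otimes>\<^bsub>?P\<^esub> t j"
      using P.commutator_eq_one_iff t[OF j] gens by simp
    show "t j \<otimes>\<^bsub>?P\<^esub> t j = \<one>\<^bsub>?P\<^esub> \<or> t j \<otimes>\<^bsub>?P\<^esub> t j = f ESZ"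
    proof -
      have "t j \<otimes>\<^bsub>?P\<^esub> t j = (if e = 1 \<and> i = g then f ESZ else \<one>\<^bsub>?P\<^esub>)"
        using i(2) rels i(1) by (elim disjE) simp_all
      then show ?thesis by metis
    qed
    fix k assume k: "k < 2 * g"
    obtain l where l: "l \<in> {1..g}" "t k = f (ESX l) \<or> t k = f (ESY l)" using cases[OF k] by blast
    show "t j \<otimes>\<^bsub>?P\<^esub> t k = t k \<otimes>\<^bsub>?P\<^esub> t j \<or> t j \<otimes>\<^bsub>?P\<^esub> t k = f ESZ \<otimes>\<^bsub>?P\<^esub> (t k \<otimes>\<^bsub>?P\<^esub> t j)"
      using i l XX[of i l] YY[of i l] XY[of i l] YX[of l i] by auto
  qed (rule gen)
qed

context extraspecial_two_group
begin

lemma commutator_zpow: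
  "\<lbrakk>x \<in> carrier G; y \<in> carrier G\<rbrakk> \<Longrightarrow> commutator x y = zpow (comm_form x y)"
  by (simp add: commutator_def commutator_eq)

lemma inv_z [simp]: "inv z = z"
  using inv_zpow[of 1] by simp

text \<open>A normal family satisfies the defining relations and generates \<open>G\<close>. The resulting epimorphism is
  injective because the presented group is not larger than \<open>G\<close>.\<close>

lemma iso_es_group_if_normal_family:
  assumes card: "card (carrier G) = 2 ^ (2 * g + 1)" and g: "g \<ge> 1" and F: "normal_family e g X Y"
  shows "G \<cong> es_group e g"
proof -
  let ?P = "es_group e g"
  interpret P: group ?P unfolding es_group_def by (rule group_presented_group)
  have S: "symplectic_family g X Y" using F by (simp add: normal_family_def)
  note XY = symplectic_family_closed[OF S]
  define f where "f x = (case x of ESX i \<Rightarrow> X (i - 1) | ESY i \<Rightarrow> Y (i - 1) | ESZ \<Rightarrow> z)" for x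
  have f: "f \<in> es_gens g \<rightarrow> carrier G" using XY by (auto simp: f_def es_gens_def)
  have sat: "satisfies_rels G (es_gens g) (es_rels e g) f"
    unfolding satisfies_es_rels_iff[OF f g]
  proof (intro conjI ballI)
    fix i assume i: "i \<in> {1..g}"
    then have i': "i - 1 < g" "Suc (i - 1) = i" by auto
    show "commutator (f (ESX i)) (f ESZ) = \<one>" "commutator (f (ESY i)) (f ESZ) = \<one>"
      using XY i' by (simp_all add: f_def commutator_zpow)
    show "f (ESX i) \<otimes> f (ESX i) = (if e = 1 \<and> i = g then f ESZ else \<one>)"
      "f (ESY i) \<otimes> f (ESY i) = (if e = 1 \<and> i = g then f ESZ else \<one>)"
      using XY i' F by (cases e; simp add: f_def square_zpow normal_family_def)+
    fix j assume "j \<in> {1..g}"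
    then have j': "j - 1 < g" "Suc (j - 1) = j" by auto
    have "i - 1 = j - 1 \<longleftrightarrow> i = j" using i'(2) j'(2) by metis
    then show "commutator (f (ESX i)) (f (ESX j)) = \<one>" "commutator (f (ESY i)) (f (ESY j)) = \<one>"
      "commutator (f (ESX i)) (f (ESY j)) = (if i = j then inv (f ESZ) else \<one>)"
      using XY i' j' S by (simp_all add: f_def commutator_zpow symplectic_family_def)
  qed (simp add: f_def z_square)
  let ?h = "pres_lift (es_gens g) (es_rels e g) f"
  have h: "?h \<in> hom ?P G" unfolding es_group_def using f sat by (rule pres_lift_hom)
  have h_gen: "?h (pres_class (es_gens g) (es_rels e g) (letter x)) = f x" if "x \<in> es_gens g" for x
    using that by (simp add: pres_lift_class[OF f sat] word_eval_letter[OF f])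
  have "?h \<in> epi ?P G"
    unfolding es_group_def epi_presented_group_iff[OF h[unfolded es_group_def]]
  proof (intro allI impI)
    fix U assume U: "subgroup U G"
      "\<forall>x\<in>es_gens g. ?h (pres_class (es_gens g) (es_rels e g) (letter x)) \<in> U"
    then have fU: "f x \<in> U" if "x \<in> es_gens g" for x using that h_gen by metis
    have "X i \<in> U" "Y i \<in> U" if "i < g" for i
      using fU[of "ESX (Suc i)"] fU[of "ESY (Suc i)"] that by (simp_all add: f_def es_gens_def)
    moreover have "z \<in> U" using fU[of ESZ] by (simp add: f_def es_gens_def)
    ultimately show "U = carrier G"
      using symplectic_family_generates[OF S family_centralizer_maximal[OF card S] U(1)] by auto
  qed
  then have img: "?h ` carrier ?P = carrier G" by (simp add: epi_def)
  have finP: "finite (carrier ?P)" and "card (carrier ?P) \<le> 2 ^ (2 * g + 1)"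
    using card_es_group_le[OF g] by auto
  then have "card (?h ` carrier ?P) = card (carrier ?P)"
    using card_image_le[OF finP, of ?h] card by (simp add: img)
  then have "inj_on ?h (carrier ?P)" using finP by (rule eq_card_imp_inj_on[rotated])
  then have "?h \<in> iso ?P G" using h img by (simp add: iso_def bij_betw_def)
  then have "?P \<cong> G" by (rule is_isoI)
  then show ?thesis by (rule P.iso_sym)
qed

text \<open>Otherwise \<open>G\<close> would be abelian, hence equal to its center.\<close>

lemma generators_not_commuting:
  assumes card: "card (carrier G) > 2" and T: "T \<subseteq> carrier G"
    and gen: "\<And>U. subgroup U G \<Longrightarrow> T \<subseteq> U \<Longrightarrow> U = carrier G"
  shows "\<exists>s\<in>T. \<exists>t\<in>T. comm_form s t = 1"
proof (rule ccontr)
  assume "\<not> ?thesis"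
  then have T0: "comm_form s t = 0" if "s \<in> T" "t \<in> T" for s t using that by auto
  have 1: "{x \<in> carrier G. \<forall>t\<in>T. comm_form x t = 0} = carrier G"
    using T T0 by (intro gen subgroup_comm_kernel) auto
  have 2: "{x \<in> carrier G. \<forall>t\<in>carrier G. comm_form x t = 0} = carrier G"
  proof (intro gen subgroup_comm_kernel)
    show "T \<subseteq> {x \<in> carrier G. \<forall>t\<in>carrier G. comm_form x t = 0}"
    proof
      fix t assume t: "t \<in> T"
      have "comm_form t x = 0" if "x \<in> carrier G" for x
      proof -
        have "x \<in> {x \<in> carrier G. \<forall>t\<in>T. comm_form x t = 0}" using that unfolding 1 .
        then show ?thesis using t by (subst comm_form_sym) simp
      qed
      then show "t \<in> {x \<in> carrier G. \<forall>t\<in>carrier G. comm_form x t = 0}" using t T by auto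
    qed
  qed simp
  then have "carrier G \<subseteq> {\<one>, z}" using comm_form_radical by blast
  then have "card (carrier G) \<le> 2" using card_center card_mono[of "{\<one>, z}"] by simp
  then show False using card by simp
qed

text \<open>The images of the standard generators form a normal family as soon as the generator \<open>ESZ\<close> is sent
  to \<open>z\<close>. Being a commutator, its image is \<open>1\<close> or \<open>z\<close>; were it \<open>1\<close>, all images of the generators would
  commute.\<close>

lemma normal_family_if_iso_es_group:
  assumes card: "card (carrier G) = 2 ^ (2 * g + 1)" and g: "g \<ge> 1" and iso: "G \<cong> es_group e g"
  shows "\<exists>X Y. normal_family e g X Y"
proof -
  let ?P = "es_group e g"
  interpret P: group ?P unfolding es_group_def by (rule group_presented_group)
  obtain h where h: "h \<in> iso ?P G" using iso_sym[OF iso] by (auto simp: is_iso_def)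
  define f where "f x = h (pres_class (es_gens g) (es_rels e g) (letter x))" for x
  have hom: "h \<in> hom (presented_group (es_gens g) (es_rels e g)) G"
    using h by (simp add: iso_def es_group_def)
  have f: "f \<in> es_gens g \<rightarrow> carrier G"
  proof
    fix x assume "x \<in> es_gens g"
    then show "f x \<in> carrier G" unfolding f_def by (intro hom_in_carrier[OF hom]) simp
  qed
  have sat: "satisfies_rels G (es_gens g) (es_rels e g) f"
    unfolding f_def using hom by (rule hom_satisfies_rels)
  note rels = sat[unfolded satisfies_es_rels_iff[OF f g]]
  have epi: "h \<in> epi (presented_group (es_gens g) (es_rels e g)) G"
    using h by (simp add: iso_iff_mon_epi es_group_def)
  have gens: "f ESZ \<in> carrier G" "i \<in> {1..g} \<Longrightarrow> f (ESX i) \<in> carrier G"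
    "i \<in> {1..g} \<Longrightarrow> f (ESY i) \<in> carrier G" for i
    using f by (auto simp: es_gens_def)
  have "inv (f ESZ) = commutator (f (ESX 1)) (f (ESY 1))" using rels g by simp
  then have "inv (f ESZ) = zpow (comm_form (f (ESX 1)) (f (ESY 1)))"
    using commutator_zpow[OF gens(2,3), of 1 1] g by simp
  then have fz: "f ESZ = zpow (comm_form (f (ESX 1)) (f (ESY 1)))"
    using gens by (metis inv_inv inv_zpow)
  have "comm_form (f (ESX 1)) (f (ESY 1)) = 1"
  proof (rule ccontr)
    assume "comm_form (f (ESX 1)) (f (ESY 1)) \<noteq> 1"
    then have fz1: "f ESZ = \<one>" using fz by simp
    have "comm_form (f x) (f y) = 0" if "x \<in> es_gens g" "y \<in> es_gens g" for x y
    proof -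
      have *: "comm_form a b = 0" if "commutator a b = \<one>" "a \<in> carrier G" "b \<in> carrier G" for a b
        using that by (simp add: commutator_zpow)
      have XY: "comm_form (f (ESX i)) (f (ESX j)) = 0" "comm_form (f (ESY i)) (f (ESY j)) = 0"
        "comm_form (f (ESX i)) (f (ESY j)) = 0" "comm_form (f (ESY j)) (f (ESX i)) = 0"
        if "i \<in> {1..g}" "j \<in> {1..g}" for i j
      proof -
        show "comm_form (f (ESX i)) (f (ESX j)) = 0" "comm_form (f (ESY i)) (f (ESY j)) = 0"
          "comm_form (f (ESX i)) (f (ESY j)) = 0"
          using that rels gens fz1 by (intro *; auto)+
        then show "comm_form (f (ESY j)) (f (ESX i)) = 0" by (simp add: comm_form_sym)
      qed
      show ?thesis using that XY gens fz1 by (auto simp: es_gens_def)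
    qed
    moreover have "\<exists>s\<in>f ` es_gens g. \<exists>t\<in>f ` es_gens g. comm_form s t = 1"
    proof (rule generators_not_commuting)
      have "(2::nat) ^ 1 < 2 ^ (2 * g + 1)" using g by (intro power_strict_increasing) auto
      then show "card (carrier G) > 2" using card by simp
      show "f ` es_gens g \<subseteq> carrier G" using f by auto
      show "U = carrier G" if "subgroup U G" "f ` es_gens g \<subseteq> U" for U
        using epi[unfolded epi_presented_group_iff[OF hom]] that by (auto simp: f_def)
    qed
    ultimately show False by auto
  qed
  then have fz: "f ESZ = z" using fz by simp
  have *: "comm_form a b = 0" if "commutator a b = \<one>" "a \<in> carrier G" "b \<in> carrier G" for a b
    using that by (simp add: commutator_zpow)
  have **: "comm_form a b = 1" if "commutator a b = z" "a \<in> carrier G" "b \<in> carrier G" for a b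
    using that z_neq_one by (cases "comm_form a b") (simp_all add: commutator_zpow)
  have S: "symplectic_family g (\<lambda>i. f (ESX (Suc i))) (\<lambda>i. f (ESY (Suc i)))"
    unfolding symplectic_family_def
  proof (intro conjI allI impI)
    fix i j assume ij: "i < g" "j < g"
    then have ij': "Suc i \<in> {1..g}" "Suc j \<in> {1..g}" by auto
    show "comm_form (f (ESX (Suc i))) (f (ESX (Suc j))) = 0"
      "comm_form (f (ESY (Suc i))) (f (ESY (Suc j))) = 0"
      using rels gens ij' by (intro *; simp)+
    show "comm_form (f (ESX (Suc i))) (f (ESY (Suc j))) = of_bool (i = j)"
      using rels gens ij' fz * ** by (cases "i = j") simp_all
  qed (use gens in auto)
  have sq: "sq_form a = (if b then e else 0)"
    if "a \<otimes> a = (if e = 1 \<and> b then f ESZ else \<one>)" "a \<in> carrier G" for a b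
    using that fz by (intro sq_form_eqI) (cases e; auto)+
  have "normal_family e g (\<lambda>i. f (ESX (Suc i))) (\<lambda>i. f (ESY (Suc i)))"
    unfolding normal_family_def
  proof (intro conjI allI impI)
    fix i assume "i < g"
    then have "Suc i \<in> {1..g}" by simp
    with rels gens show "sq_form (f (ESX (Suc i))) = (if Suc i = g then e else 0)"
      "sq_form (f (ESY (Suc i))) = (if Suc i = g then e else 0)"
      by (intro sq; blast)+
  qed (rule S)
  then show ?thesis by blast
qed

lemma card_sq_form_1_A_factor:
  assumes card: "card (carrier G) = 2 ^ (2 * g + 1)" and g: "g \<ge> 1"
  shows "card {x \<in> carrier G. sq_form x = 1} = 2 * A_factor g G"
proof -
  have count: "card {x \<in> carrier G. sq_form x = 1} =
      2 * (if e = 0 then 2 ^ (2 * g - 1) - 2 ^ (g - 1) else 2 ^ (2 * g - 1) + 2 ^ (g - 1))"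
    if iso: "G \<cong> es_group e g" for e
    using normal_family_if_iso_es_group[OF card g iso] card_sq_form_1_normal_family[OF card _ g]
    by blast
  obtain e X Y where "normal_family e g X Y" using normal_family_exists[OF card] by blast
  then have "G \<cong> es_group e g" by (rule iso_es_group_if_normal_family[OF card g])
  then have "G \<cong> H_group g \<or> G \<cong> G_group g"
    by (cases e) (simp_all add: es_group_simps)
  then show ?thesis
    using count[of 0] count[of 1] by (auto simp: A_factor_def es_group_simps)
qed

end


section \<open>Admissible epimorphisms\<close>

lemma of_nat_bit: "(of_nat n :: bit) = of_bool (odd n)"
  by (induction n) auto

context extraspecial_two_group
begin

text \<open>In each relation on a single commutator the inner letter is flanked by two factors \<open>\<sigma>\<close> or \<open>\<sigma>\<inverse>\<close>, whose
  contributions to the commutator form are equal and cancel. The first two families of relations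
  become \<open>c(x, x) = 0\<close>, which holds for every \<open>x\<close>.\<close>

lemma satisfies_braid_rels_iff:
  assumes f: "f \<in> braid_gens g \<rightarrow> carrier G"
  shows "satisfies_rels G (braid_gens g) (braid_rels g) f \<longleftrightarrow>
    (\<forall>i\<in>{1..g}. \<forall>j\<in>{1..g}. j < i \<longrightarrow>
      comm_form (f (BA i)) (f (BA j)) = 0 \<and> comm_form (f (BA i)) (f (BB j)) = 0 \<and>
      comm_form (f (BB i)) (f (BA j)) = 0 \<and> comm_form (f (BB i)) (f (BB j)) = 0) \<and>
    (\<forall>i\<in>{1..g}. comm_form (f (BA i)) (f (BB i)) = sq_form (f BSigma)) \<and>
    (\<Sum>i=1..g. comm_form (f (BA i)) (f (BB i))) = sq_form (f BSigma)"
    (is "?L \<longleftrightarrow> ?R")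
proof -
  let ?ev = "word_eval G f"
  define ok where "ok uv \<longleftrightarrow> ?ev (fst uv) = ?ev (snd uv)" for uv
  have gens: "BA i \<in> braid_gens g \<longleftrightarrow> i \<in> {1..g}" "BB i \<in> braid_gens g \<longleftrightarrow> i \<in> {1..g}"
    "BSigma \<in> braid_gens g" for i
    by (auto simp: braid_gens_def)
  have fG: "x \<in> braid_gens g \<Longrightarrow> f x \<in> carrier G" for x using f by auto
  have comm: "?ev (wcomm u v) = zpow (comm_form (?ev u) (?ev v))"
    if "u \<in> words (braid_gens g)" "v \<in> words (braid_gens g)" for u v
    using that by (simp add: word_eval_wcomm[OF f] word_eval_closed[OF f] commutator_eq)
  have lt: "?ev (letter x) = f x" "?ev (winv (letter x)) = inv (f x)" if "x \<in> braid_gens g" for x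
    using that by (simp_all add: word_eval_winv[OF f] word_eval_letter[OF f])
  have app: "?ev (u @ v) = ?ev u \<otimes> ?ev v"
    if "u \<in> words (braid_gens g)" "v \<in> words (braid_gens g)" for u v
    using that by (rule word_eval_append[OF f])
  have same: "?ev (wcomm (letter x) (winv (letter BSigma) @ letter y @ winv (letter BSigma))) =
      zpow (comm_form (f x) (f y))" if "x \<in> braid_gens g" "y \<in> braid_gens g" for x y
    using that fG gens by (simp add: comm app lt comm_form_mult_right)
  have conj: "?ev (wcomm (letter x) (winv (letter BSigma) @ letter y @ letter BSigma)) =
      zpow (comm_form (f x) (f y))" if "x \<in> braid_gens g" "y \<in> braid_gens g" for x y
    using that fG gens by (simp add: comm app lt comm_form_mult_right)
  have ss: "?ev (letter BSigma @ letter BSigma) = zpow (sq_form (f BSigma))"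
    using fG gens by (simp add: app lt square_zpow)
  have prod: "?ev (concat (map (\<lambda>i. wcomm (letter (BA i)) (winv (letter (BB i)))) [1..<Suc k])) =
      zpow (\<Sum>i=1..k. comm_form (f (BA i)) (f (BB i))) \<and>
      concat (map (\<lambda>i. wcomm (letter (BA i)) (winv (letter (BB i)))) [1..<Suc k]) \<in> words (braid_gens g)"
    if "k \<le> g" for k
    using that
  proof (induction k)
    case (Suc k)
    then have "Suc k \<in> {1..g}" by simp
    with Suc fG gens show ?case
      by (simp add: app comm lt zpow_add)
  qed simp
  have words: "\<forall>(u, v)\<in>braid_rels g. u \<in> words (braid_gens g) \<and> v \<in> words (braid_gens g)"
    using prod[of g] by (auto simp: braid_rels_def Let_def gens)
  have all_ok: "?L \<longleftrightarrow> (\<forall>uv\<in>braid_rels g. ok uv)"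
    using words by (fastforce simp: satisfies_rels_def ok_def)
  have ball1: "(\<forall>uv\<in>{h i |i. P i}. ok uv) \<longleftrightarrow> (\<forall>i. P i \<longrightarrow> ok (h i))"
    for h :: "nat \<Rightarrow> braid_gen word \<times> braid_gen word" and P by blast
  have ball2: "(\<forall>uv\<in>{h i j |i j. P i j}. ok uv) \<longleftrightarrow> (\<forall>i j. P i j \<longrightarrow> ok (h i j))"
    for h :: "nat \<Rightarrow> nat \<Rightarrow> braid_gen word \<times> braid_gen word" and P by blast
  have last: "ok (concat (map (\<lambda>i. wcomm (letter (BA i)) (winv (letter (BB i)))) [1..<Suc g]),
      letter BSigma @ letter BSigma) \<longleftrightarrow>
      (\<Sum>i=1..g. comm_form (f (BA i)) (f (BB i))) = sq_form (f BSigma)"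
    using prod[of g] by (simp add: ok_def ss del: upt_Suc)
  have single: "(\<forall>uv\<in>{x}. ok uv) \<longleftrightarrow> ok x" for x by simp
  have a: "ok (wcomm (letter x) (winv (letter BSigma) @ letter x @ winv (letter BSigma)), [])"
    if "x \<in> braid_gens g" for x
    using that same[of x x] by (simp add: ok_def)
  have b: "ok (wcomm (letter x) (winv (letter BSigma) @ letter y @ letter BSigma), []) \<longleftrightarrow>
      comm_form (f x) (f y) = 0" if "x \<in> braid_gens g" "y \<in> braid_gens g" for x y
    using that conj[of x y] by (simp add: ok_def)
  have c: "ok (wcomm (letter x) (winv (letter BSigma) @ letter y @ winv (letter BSigma)),
        letter BSigma @ letter BSigma) \<longleftrightarrow>
      comm_form (f x) (f y) = sq_form (f BSigma)" if "x \<in> braid_gens g" "y \<in> braid_gens g" for x y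
    using that same[of x y] by (simp add: ok_def ss)
  have "?L \<longleftrightarrow>
    (\<forall>i j. i \<in> {1..g} \<and> j \<in> {1..g} \<and> j < i \<longrightarrow> comm_form (f (BA i)) (f (BA j)) = 0) \<and>
    (\<forall>i j. i \<in> {1..g} \<and> j \<in> {1..g} \<and> j < i \<longrightarrow> comm_form (f (BA i)) (f (BB j)) = 0) \<and>
    (\<forall>i j. i \<in> {1..g} \<and> j \<in> {1..g} \<and> j < i \<longrightarrow> comm_form (f (BB i)) (f (BA j)) = 0) \<and>
    (\<forall>i j. i \<in> {1..g} \<and> j \<in> {1..g} \<and> j < i \<longrightarrow> comm_form (f (BB i)) (f (BB j)) = 0) \<and>
    (\<forall>i. i \<in> {1..g} \<longrightarrow> comm_form (f (BA i)) (f (BB i)) = sq_form (f BSigma)) \<and>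
    (\<Sum>i=1..g. comm_form (f (BA i)) (f (BB i))) = sq_form (f BSigma)"
    unfolding all_ok unfolding braid_rels_def Let_def ball_Un ball1 ball2 single last
    by (simp add: a b c gens cong: imp_cong del: atLeastAtMost_iff)
  then show ?thesis by (simp only:) blast
qed

lemma braid_rels_comm_form:
  assumes f: "f \<in> braid_gens g \<rightarrow> carrier G"
    and sat: "satisfies_rels G (braid_gens g) (braid_rels g) f"
    and ij: "i \<in> {1..g}" "j \<in> {1..g}"
  shows "comm_form (f (BA i)) (f (BA j)) = 0" "comm_form (f (BB i)) (f (BB j)) = 0"
    "comm_form (f (BA i)) (f (BB j)) = (if i = j then sq_form (f BSigma) else 0)"
proof -
  note rels = sat[unfolded satisfies_braid_rels_iff[OF f]]
  have lower: "comm_form (f (BA k)) (f (BA l)) = 0 \<and> comm_form (f (BA k)) (f (BB l)) = 0 \<and>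
      comm_form (f (BB k)) (f (BA l)) = 0 \<and> comm_form (f (BB k)) (f (BB l)) = 0"
    if "k \<in> {1..g}" "l \<in> {1..g}" "l < k" for k l
    using rels[THEN conjunct1] that by blast
  have upper: "comm_form (f (BA l)) (f (BA k)) = 0 \<and> comm_form (f (BA l)) (f (BB k)) = 0 \<and>
      comm_form (f (BB l)) (f (BB k)) = 0"
    if "k \<in> {1..g}" "l \<in> {1..g}" "l < k" for k l
    using lower[OF that] by (simp add: comm_form_sym)
  have diag: "comm_form (f (BA k)) (f (BB k)) = sq_form (f BSigma)" if "k \<in> {1..g}" for k
    using rels[THEN conjunct2, THEN conjunct1] that by blast
  show "comm_form (f (BA i)) (f (BA j)) = 0" "comm_form (f (BB i)) (f (BB j)) = 0"
    "comm_form (f (BA i)) (f (BB j)) = (if i = j then sq_form (f BSigma) else 0)"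
    using lower[of i j] upper[of j i] diag[of i] ij by (cases i j rule: linorder_cases; simp)+
qed

lemma braid_generators_cases:
  assumes "x \<in> braid_gens g"
  obtains i where "i < g" "x = BA (Suc i)" | i where "i < g" "x = BB (Suc i)" | "x = BSigma"
proof -
  have "\<exists>k<g. i = Suc k" if "i \<in> {1..g}" for i using that by (cases i) auto
  then show ?thesis using assms that unfolding braid_gens_def by blast
qed

text \<open>Used for sets cut out by a condition with values in \<open>\<int>/2\<close>: multiplying by an element that
  violates the condition maps the remaining elements into the set.\<close>

lemma card_le_double:
  assumes "finite K" "d \<in> carrier G" "C \<subseteq> carrier G" "\<And>x. x \<in> C \<Longrightarrow> x \<in> K \<or> x \<otimes> d \<in> K"
  shows "card C \<le> 2 * card K"
proof -
  let ?C' = "{x \<in> C. x \<otimes> d \<in> K}"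
  have fin: "finite C" using assms(3) finite_carrier by (rule finite_subset)
  have "inj_on (\<lambda>x. x \<otimes> d) ?C'"
    using assms(2,3) by (intro inj_onI) (auto simp: subset_iff)
  then have "card ?C' \<le> card K"
    by (rule card_inj_on_le) (use assms(1) in auto)
  moreover have "card C \<le> card (K \<union> ?C')"
    using assms fin by (intro card_mono) auto
  ultimately show ?thesis using card_Un_le[of K ?C'] by linarith
qed

text \<open>If \<open>s\<^sup>2 = 1\<close>, the elements \<open>a\<^sub>i, b\<^sub>i\<close> commute with each other. Their centralizer \<open>D\<close> then contains
  all of them and has index at most two, as \<open>s\<close> is the only further generator. The part of \<open>D\<close> that
  commutes with \<open>s\<close> is central and has index at most two in \<open>D\<close>. Thus \<open>G\<close> has at most eight elements.\<close>

lemma sq_form_sigma: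
  assumes card: "card (carrier G) = 2 ^ (2 * g + 1)" and g: "g \<ge> 2"
    and f: "f \<in> braid_gens g \<rightarrow> carrier G"
    and sat: "satisfies_rels G (braid_gens g) (braid_rels g) f"
    and gen: "\<And>S. subgroup S G \<Longrightarrow> \<forall>x\<in>braid_gens g. f x \<in> S \<Longrightarrow> S = carrier G"
  shows "sq_form (f BSigma) = 1"
proof (rule ccontr)
  assume "sq_form (f BSigma) \<noteq> 1"
  then have q0: "sq_form (f BSigma) = 0" by simp
  define T where "T = f ` (BA ` {1..g} \<union> BB ` {1..g})"
  let ?s = "f BSigma"
  have sG: "?s \<in> carrier G" and TG: "T \<subseteq> carrier G"
    using f by (auto simp: T_def braid_gens_def)
  have gen': "S = carrier G" if "subgroup S G" "T \<subseteq> S" "?s \<in> S" for S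
    using that gen[OF that(1)] by (auto simp: T_def braid_gens_def)
  have comm0: "comm_form (f (BA i)) (f (BA j)) = 0" "comm_form (f (BB i)) (f (BB j)) = 0"
    "comm_form (f (BA i)) (f (BB j)) = 0" "comm_form (f (BB j)) (f (BA i)) = 0"
    if "i \<in> {1..g}" "j \<in> {1..g}" for i j
  proof -
    note c = braid_rels_comm_form[OF f sat that]
    show "comm_form (f (BA i)) (f (BA j)) = 0" "comm_form (f (BB i)) (f (BB j)) = 0"
      "comm_form (f (BA i)) (f (BB j)) = 0"
      using c q0 by simp_all
    then show "comm_form (f (BB j)) (f (BA i)) = 0" by (simp add: comm_form_sym)
  qed
  have T0: "comm_form a b = 0" if "a \<in> T" "b \<in> T" for a b
    using that comm0 unfolding T_def by (elim imageE UnE) (simp_all only:)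
  define D where "D = {x \<in> carrier G. \<forall>t\<in>T. comm_form x t = 0}"
  define D' where "D' = {x \<in> D. comm_form x ?s = 0}"
  have D: "subgroup D G" unfolding D_def using TG by (rule subgroup_comm_kernel)
  have finD: "finite D" using finite_carrier by (simp add: D_def)
  have "{x \<in> carrier G. x \<in> D \<or> x \<otimes> ?s \<in> D} = carrier G" (is "?U = _")
  proof (rule gen')
    have U: "?U = {x \<in> carrier G. (\<forall>t\<in>T. comm_form x t = 0) \<or> (\<forall>t\<in>T. comm_form x t = comm_form ?s t)}"
      using sG TG by (auto simp: D_def comm_form_mult_left bit_add_eq_0_iff subset_iff)
    show "subgroup ?U G" unfolding U
      using TG sG by (intro subgroupI) (auto simp: comm_form_mult_left subset_iff)
    show "T \<subseteq> ?U" using T0 TG by (auto simp: D_def)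
    show "?s \<in> ?U" unfolding U using sG by simp
  qed
  then have 1: "card (carrier G) \<le> 2 * card D"
    using finD sG by (intro card_le_double[of D ?s]) auto
  have "x \<in> {\<one>, z}" if x: "x \<in> D'" for x
  proof (rule comm_form_radical)
    show xG: "x \<in> carrier G" using x by (simp add: D'_def D_def)
    have sym: "comm_form y x = comm_form x y" for y by (rule comm_form_sym)
    have "{y \<in> carrier G. \<forall>t\<in>{x}. comm_form y t = 0} = carrier G"
      using x xG TG sG
      by (intro gen' subgroup_comm_kernel) (auto simp: D'_def D_def subset_iff sym)
    note all = this
    show "comm_form x y = 0" if "y \<in> carrier G" for y
    proof -
      have "y \<in> {y \<in> carrier G. \<forall>t\<in>{x}. comm_form y t = 0}" using that unfolding all .
      then show ?thesis by (simp add: sym)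
    qed
  qed
  then have "D' \<subseteq> {\<one>, z}" by blast
  then have D'2: "card D' \<le> 2" using card_center card_mono[of "{\<one>, z}" D'] by simp
  have "card D \<le> 2 * card D'"
  proof (cases "D = D'")
    case False
    then have "\<exists>d\<in>D. comm_form d ?s \<noteq> 0" unfolding D'_def by blast
    then obtain d where d: "d \<in> D" "comm_form d ?s = 1" by auto
    have DG: "D \<subseteq> carrier G" by (auto simp: D_def)
    have "x \<in> D' \<or> x \<otimes> d \<in> D'" if x: "x \<in> D" for x
    proof (cases "comm_form x ?s = 0")
      case True
      then show ?thesis using x by (simp add: D'_def)
    next
      case False
      have "x \<in> carrier G" "d \<in> carrier G" using x d DG by auto
      with False show ?thesis
        using x d sG D by (simp add: D'_def comm_form_mult_left subgroup.m_closed)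
    qed
    then show ?thesis using finD d DG by (intro card_le_double[of D' d]) (auto simp: D'_def)
  qed simp
  with 1 D'2 have "(2::nat) ^ (2 * g + 1) \<le> 8" using card by linarith
  moreover have "(2::nat) ^ 5 \<le> 2 ^ (2 * g + 1)" using g by (intro power_increasing) auto
  ultimately show False by simp
qed

text \<open>The shape of the generator images of an admissible epimorphism.\<close>

definition braid_family :: "nat \<Rightarrow> (braid_gen \<Rightarrow> 'a) \<Rightarrow> bool" where
  "braid_family g f \<longleftrightarrow>
     symplectic_family g (\<lambda>i. f (BA (Suc i))) (\<lambda>i. f (BB (Suc i))) \<and> sq_form (f BSigma) = 1"

text \<open>The values \<open>c(a\<^sub>i, b\<^sub>i)\<close> are all equal to \<open>q(s)\<close>, and so is their sum; for \<open>q(s) = 1\<close> this means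
  that \<open>g\<close> is odd. A symplectic family generates \<open>G\<close> because the commutator of one of its pairs is \<open>z\<close>.\<close>

lemma braid_family_iff:
  assumes card: "card (carrier G) = 2 ^ (2 * g + 1)" and g: "g \<ge> 2"
    and f: "f \<in> braid_gens g \<rightarrow> carrier G"
  shows "satisfies_rels G (braid_gens g) (braid_rels g) f \<and>
      (\<forall>S. subgroup S G \<longrightarrow> (\<forall>x\<in>braid_gens g. f x \<in> S) \<longrightarrow> S = carrier G) \<longleftrightarrow>
    odd g \<and> braid_family g f" (is "?L \<longleftrightarrow> ?R")
proof
  assume L: ?L
  then have q: "sq_form (f BSigma) = 1" using sq_form_sigma[OF card g f] by blast
  note rels = L[THEN conjunct1, unfolded satisfies_braid_rels_iff[OF f] q]
  have "(\<Sum>i=1..g. comm_form (f (BA i)) (f (BB i))) = (\<Sum>i=1..g. 1)"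
    using rels by (intro sum.cong) auto
  moreover have "(\<Sum>i=1..g. comm_form (f (BA i)) (f (BB i))) = 1" using rels by blast
  ultimately have "(of_nat g :: bit) = 1" by simp
  then have "odd g" by (simp add: of_nat_bit)
  moreover have "symplectic_family g (\<lambda>i. f (BA (Suc i))) (\<lambda>i. f (BB (Suc i)))"
    unfolding symplectic_family_def
  proof (intro conjI allI impI)
    fix i j assume ij: "i < g" "j < g"
    then have ij': "Suc i \<in> {1..g}" "Suc j \<in> {1..g}" by auto
    show "comm_form (f (BA (Suc i))) (f (BA (Suc j))) = 0"
      "comm_form (f (BB (Suc i))) (f (BB (Suc j))) = 0"
      "comm_form (f (BA (Suc i))) (f (BB (Suc j))) = of_bool (i = j)"
      using braid_rels_comm_form[OF f L[THEN conjunct1] ij'] q by simp_all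
  qed (use f in \<open>auto simp: braid_gens_def\<close>)
  ultimately show ?R using q by (simp add: braid_family_def)
next
  assume R: ?R
  then have S: "symplectic_family g (\<lambda>i. f (BA (Suc i))) (\<lambda>i. f (BB (Suc i)))"
    and q: "sq_form (f BSigma) = 1" by (auto simp: braid_family_def)
  have c: "comm_form (f (BA i)) (f (BA j)) = 0" "comm_form (f (BB i)) (f (BB j)) = 0"
    "comm_form (f (BA i)) (f (BB j)) = of_bool (i = j)"
    if ij: "i \<in> {1..g}" "j \<in> {1..g}" for i j
  proof -
    obtain k l where "i = Suc k" "j = Suc l" "k < g" "l < g"
      using ij by (cases i; cases j) auto
    then show "comm_form (f (BA i)) (f (BA j)) = 0" "comm_form (f (BB i)) (f (BB j)) = 0"
      "comm_form (f (BA i)) (f (BB j)) = of_bool (i = j)"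
      using S by (simp_all add: symplectic_family_def)
  qed
  have c': "comm_form (f (BB i)) (f (BA j)) = of_bool (i = j)" if "i \<in> {1..g}" "j \<in> {1..g}" for i j
    using c(3)[OF that(2,1)] comm_form_sym[of "f (BB i)"] by auto
  have "(\<Sum>i=1..g. comm_form (f (BA i)) (f (BB i))) = (\<Sum>i=1..g. 1)"
    using c by (intro sum.cong) auto
  also have "\<dots> = 1" using R by (simp add: of_nat_bit)
  finally have "satisfies_rels G (braid_gens g) (braid_rels g) f"
    unfolding satisfies_braid_rels_iff[OF f] using c c' q by simp
  moreover have "U = carrier G" if U: "subgroup U G" "\<forall>x\<in>braid_gens g. f x \<in> U" for U
  proof (rule symplectic_family_generates[OF S family_centralizer_maximal[OF card S] U(1)])
    have one: "1 \<in> {1..g}" using g by simp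
    then have AB: "f (BA 1) \<in> U" "f (BB 1) \<in> U" using U(2) by (auto simp: braid_gens_def)
    then have "f (BA 1) \<in> carrier G" "f (BB 1) \<in> carrier G"
      using subgroup.subset[OF U(1)] by auto
    then have "f (BA 1) \<otimes> f (BB 1) \<otimes> inv f (BA 1) \<otimes> inv f (BB 1) = z"
      using c(3)[OF one one] by (simp add: commutator_eq)
    then show "z \<in> U"
      using AB U(1) by (metis subgroup.m_closed subgroup.m_inv_closed)
  qed (use U in \<open>auto simp: braid_gens_def\<close>)
  ultimately show ?L by blast
qed

text \<open>In a symplectic pair \<open>u, v\<close> one of \<open>u\<close>, \<open>v\<close>, \<open>uv\<close> has order four, since
  \<open>q(uv) = q(u) + q(v) + 1\<close>.\<close>

lemma braid_family_exists:
  assumes card: "card (carrier G) = 2 ^ (2 * g + 1)" and g: "g \<ge> 1"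
  shows "\<exists>f\<in>braid_gens g \<rightarrow>\<^sub>E carrier G. braid_family g f"
proof -
  obtain e X Y where "normal_family e g X Y" using normal_family_exists[OF card] by blast
  then have S: "symplectic_family g X Y" by (simp add: normal_family_def)
  note XY = symplectic_family_closed[OF S]
  have "sq_form (X 0 \<otimes> Y 0) = sq_form (X 0) + sq_form (Y 0) + 1"
    using XY[of 0] S g by (simp add: sq_form_mult symplectic_family_def)
  then have "\<exists>s\<in>{X 0, Y 0, X 0 \<otimes> Y 0}. sq_form s = 1"
    by (cases "sq_form (X 0)"; cases "sq_form (Y 0)") auto
  then obtain s where s: "s \<in> carrier G" "sq_form s = 1" using XY[of 0] g by auto
  define f where "f = (\<lambda>x\<in>braid_gens g. case x of BA i \<Rightarrow> X (i - 1) | BB i \<Rightarrow> Y (i - 1) | BSigma \<Rightarrow> s)"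
  have "f \<in> braid_gens g \<rightarrow>\<^sub>E carrier G"
    unfolding f_def using XY s by (intro restrict_PiE_iff[THEN iffD2]) (auto simp: braid_gens_def split: braid_gen.split)
  moreover have "symplectic_family g (\<lambda>i. f (BA (Suc i))) (\<lambda>i. f (BB (Suc i)))"
    using S by (auto simp: f_def braid_gens_def symplectic_family_def)
  moreover have "f BSigma = s" by (simp add: f_def braid_gens_def)
  ultimately have "braid_family g f" "f \<in> braid_gens g \<rightarrow>\<^sub>E carrier G"
    using s by (simp_all only: braid_family_def)
  then show ?thesis by blast
qed

text \<open>The data split into a symplectic family, indexed by \<open>0, \<dots>, 2g - 1\<close> instead of the braid generators,
  and an independent choice of the image of \<open>\<sigma>\<close>.\<close>

lemma card_braid_families:
  assumes card: "card (carrier G) = 2 ^ (2 * g + 1)" and g: "g \<ge> 1"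
  shows "card {f \<in> braid_gens g \<rightarrow>\<^sub>E carrier G. braid_family g f} =
    2 ^ (2 * g) * card (Sp_F2 g) * card {x \<in> carrier G. sq_form x = 1}"
proof -
  let ?B = "{f \<in> braid_gens g \<rightarrow>\<^sub>E carrier G. braid_family g f}"
  let ?S = "{F \<in> {..<2 * g} \<rightarrow>\<^sub>E carrier G. symplectic_family g F (\<lambda>i. F (g + i))}"
  let ?Q = "{x \<in> carrier G. sq_form x = 1}"
  define gen where "gen j = (if j < g then BA (Suc j) else BB (Suc (j - g)))" for j
  define encode where "encode f = ((\<lambda>j\<in>{..<2 * g}. f (gen j)), f BSigma)" for f :: "braid_gen \<Rightarrow> 'a"
  define decode where "decode p = (\<lambda>x\<in>braid_gens g. case x of BA i \<Rightarrow> fst p (i - 1)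
    | BB i \<Rightarrow> fst p (g + (i - 1)) | BSigma \<Rightarrow> snd p)" for p :: "(nat \<Rightarrow> 'a) \<times> 'a"
  have gen_in: "gen j \<in> braid_gens g" if "j < 2 * g" for j
    using that by (auto simp: gen_def braid_gens_def)
  have family_cong: "symplectic_family g X Y \<longleftrightarrow> symplectic_family g X' Y'"
    if "\<And>i. i < g \<Longrightarrow> X i = X' i" "\<And>i. i < g \<Longrightarrow> Y i = Y' i" for X Y X' Y'
    using that by (auto simp: symplectic_family_def Pi_iff)
  have "bij_betw encode ?B (?S \<times> ?Q)"
  proof (rule bij_betw_byWitness[where f' = "decode"])
    show "\<forall>f\<in>?B. decode (encode f) = f"
    proof
      fix f assume f: "f \<in> ?B"
      show "decode (encode f) = f"
      proof
        fix x
        show "decode (encode f) x = f x"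
        proof (cases "x \<in> braid_gens g")
          case True
          then show ?thesis
            by (cases rule: braid_generators_cases) (auto simp: decode_def encode_def gen_def braid_gens_def)
        next
          case False
          then show ?thesis using f by (auto simp: decode_def PiE_def extensional_def)
        qed
      qed
    qed
    show "\<forall>p\<in>?S \<times> ?Q. encode (decode p) = p"
    proof
      fix p assume p: "p \<in> ?S \<times> ?Q"
      have "(\<lambda>j\<in>{..<2 * g}. decode p (gen j)) = fst p"
      proof
        fix j
        show "(\<lambda>j\<in>{..<2 * g}. decode p (gen j)) j = fst p j"
        proof (cases "j < 2 * g")
          case True
          then show ?thesis using gen_in[OF True] by (auto simp: decode_def gen_def)
        next
          case False
          then show ?thesis using p by (auto simp: PiE_def extensional_def)
        qed
      qed
      then show "encode (decode p) = p" by (simp add: encode_def) (simp add: decode_def braid_gens_def)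
    qed
    show "encode ` ?B \<subseteq> ?S \<times> ?Q"
    proof
      fix p assume "p \<in> encode ` ?B"
      then obtain f where f: "f \<in> braid_gens g \<rightarrow>\<^sub>E carrier G" "braid_family g f" "p = encode f" by blast
      have "(\<lambda>j\<in>{..<2 * g}. f (gen j)) \<in> {..<2 * g} \<rightarrow>\<^sub>E carrier G"
        using f(1) gen_in by (intro restrict_PiE_iff[THEN iffD2]) auto
      moreover have "symplectic_family g (\<lambda>j\<in>{..<2 * g}. f (gen j)) (\<lambda>i. (\<lambda>j\<in>{..<2 * g}. f (gen j)) (g + i))"
        using f(2) by (subst family_cong[of _ "\<lambda>i. f (BA (Suc i))" _ "\<lambda>i. f (BB (Suc i))"])
          (auto simp: gen_def braid_family_def)
      moreover have "f BSigma \<in> carrier G" using f(1) by (auto simp: braid_gens_def)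
      ultimately show "p \<in> ?S \<times> ?Q" using f by (simp add: encode_def braid_family_def)
    qed
    show "decode ` (?S \<times> ?Q) \<subseteq> ?B"
    proof
      fix f assume "f \<in> decode ` (?S \<times> ?Q)"
      then obtain F s where p: "F \<in> {..<2 * g} \<rightarrow>\<^sub>E carrier G" "symplectic_family g F (\<lambda>i. F (g + i))"
          "s \<in> carrier G" "sq_form s = 1" "f = decode (F, s)" by blast
      have FG: "F j \<in> carrier G" if "j < 2 * g" for j using p(1) that by auto
      have "f \<in> braid_gens g \<rightarrow>\<^sub>E carrier G"
        unfolding p(5) decode_def using FG p(3)
        by (intro restrict_PiE_iff[THEN iffD2]) (auto simp: braid_gens_def)
      moreover have "symplectic_family g (\<lambda>i. f (BA (Suc i))) (\<lambda>i. f (BB (Suc i)))"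
        using p(2) by (subst family_cong[of _ F _ "\<lambda>i. F (g + i)"])
          (auto simp: p(5) decode_def braid_gens_def)
      moreover have "f BSigma = s" by (simp add: p(5) decode_def braid_gens_def)
      ultimately show "f \<in> ?B" using p by (simp add: braid_family_def)
    qed
  qed
  then have "card ?B = card ?S * card ?Q"
    by (simp add: bij_betw_same_card card_cartesian_product)
  then show ?thesis by (simp only: card_symplectic_families[OF card g])
qed

text \<open>Surjectivity forces \<open>q(s) = 1\<close>, and then \<open>s\<close> is not the identity.\<close>

lemma admissible_iff:
  assumes card: "card (carrier G) = 2 ^ (2 * g + 1)" and g: "g \<ge> 2"
    and h: "h \<in> hom (B2 g) G"
  shows "admissible g G h \<longleftrightarrow> odd g \<and>
    braid_family g (\<lambda>x\<in>braid_gens g. h (pres_class (braid_gens g) (braid_rels g) (letter x)))"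
proof -
  define f where "f = (\<lambda>x\<in>braid_gens g. h (pres_class (braid_gens g) (braid_rels g) (letter x)))"
  have h': "h \<in> hom (presented_group (braid_gens g) (braid_rels g)) G" using h by (simp add: B2_def)
  have fs: "f \<in> {f \<in> braid_gens g \<rightarrow>\<^sub>E carrier G. satisfies_rels G (braid_gens g) (braid_rels g) f}"
    unfolding f_def
  proof (intro CollectI conjI restrict_PiE_iff[THEN iffD2] ballI)
    fix x assume "x \<in> braid_gens g"
    then show "h (pres_class (braid_gens g) (braid_rels g) (letter x)) \<in> carrier G"
      by (intro hom_in_carrier[OF h']) simp
  next
    show "satisfies_rels G (braid_gens g) (braid_rels g)
        (\<lambda>x\<in>braid_gens g. h (pres_class (braid_gens g) (braid_rels g) (letter x)))"
      using hom_satisfies_rels[OF h'] by (subst satisfies_rels_cong) auto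
  qed
  then have f: "f \<in> braid_gens g \<rightarrow> carrier G" and sat: "satisfies_rels G (braid_gens g) (braid_rels g) f"
    by (auto simp: PiE_def)
  have epi: "h \<in> epi (B2 g) G \<longleftrightarrow> odd g \<and> braid_family g f"
    using epi_presented_group_iff[OF h'] braid_family_iff[OF card g f] sat
    by (simp add: B2_def f_def)
  have sigma: "h (braid_sigma g) = f BSigma"
    by (simp add: braid_sigma_def f_def braid_gens_def)
  have sG: "f BSigma \<in> carrier G" using f by (auto simp: braid_gens_def)
  have "ord (f BSigma) \<ge> 2" if "braid_family g f"
  proof -
    have "f BSigma \<noteq> \<one>" using that by (auto simp: braid_family_def)
    then have "ord (f BSigma) \<noteq> 1" using ord_eq_1[OF sG] by simp
    moreover have "ord (f BSigma) \<ge> 1" using ord_ge_1[OF finite_carrier sG] by simp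
    ultimately show ?thesis by simp
  qed
  then show ?thesis using epi by (auto simp: admissible_def sigma f_def[symmetric])
qed

lemma bij_betw_admissible:
  assumes card: "card (carrier G) = 2 ^ (2 * g + 1)" and g: "g \<ge> 2" and odd: "odd g"
  shows "bij_betw (\<lambda>h. \<lambda>x\<in>braid_gens g. h (pres_class (braid_gens g) (braid_rels g) (letter x)))
     {h \<in> extensional (carrier (B2 g)). admissible g G h}
     {f \<in> braid_gens g \<rightarrow>\<^sub>E carrier G. braid_family g f}"
proof -
  let ?res = "\<lambda>h. \<lambda>x\<in>braid_gens g. h (pres_class (braid_gens g) (braid_rels g) (letter x))"
  let ?H = "hom (B2 g) G \<inter> extensional (carrier (B2 g))"
  let ?F = "{f \<in> braid_gens g \<rightarrow>\<^sub>E carrier G. satisfies_rels G (braid_gens g) (braid_rels g) f}"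
  have filter_image: "{f \<in> F. P f} = r ` {h \<in> H. P (r h)}" if "r ` H = F"
    for r :: "(braid_gen word set \<Rightarrow> 'a) \<Rightarrow> braid_gen \<Rightarrow> 'a" and H F P
    using that by blast
  have bij: "bij_betw ?res ?H ?F" unfolding B2_def by (rule bij_betw_hom_presented_group)
  have A: "{h \<in> extensional (carrier (B2 g)). admissible g G h} = {h \<in> ?H. braid_family g (?res h)}"
    using admissible_iff[OF card g] odd by (auto simp: admissible_def epi_def)
  have "{f \<in> braid_gens g \<rightarrow>\<^sub>E carrier G. braid_family g f} = {f \<in> ?F. braid_family g f}"
    using braid_family_iff[OF card g] odd by (auto simp: PiE_def)
  also have "\<dots> = ?res ` {h \<in> ?H. braid_family g (?res h)}"
    by (rule filter_image[OF bij_betw_imp_surj_on[OF bij]])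
  finally show ?thesis
    using bij_betw_subset[OF bij, of "{h \<in> ?H. braid_family g (?res h)}"] unfolding A by auto
qed

end

theorem theoremD:
  fixes g :: nat and G :: "('a, 'b) monoid_scheme"
  assumes "g \<ge> 2"
    and "extra_special 2 G"
    and "order G = 2 ^ (2 * g + 1)"
  shows "(admissible_quotient g G \<longleftrightarrow> odd g) \<and>
    (odd g \<longrightarrow> num_admissible g G = 2 ^ (2 * g + 1) * A_factor g G * card (Sp_F2 g))"
proof -
  obtain z where "extraspecial_two_group G z"
    using extra_special_imp_extraspecial_two_group[OF assms(2)] by blast
  then interpret extraspecial_two_group G z .
  have card: "card (carrier G) = 2 ^ (2 * g + 1)" using assms(3) by (simp add: order_def)
  have g: "g \<ge> 1" using assms(1) by simp
  note bij = bij_betw_admissible[OF card assms(1)]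
  have "odd g" if "admissible_quotient g G"
    using that admissible_iff[OF card assms(1)]
    by (auto simp: admissible_quotient_def admissible_def epi_def)
  moreover have "admissible_quotient g G" if "odd g"
    using braid_family_exists[OF card g] bij_betw_imp_surj_on[OF bij[OF that]]
    unfolding admissible_quotient_def by blast
  moreover have "num_admissible g G = 2 ^ (2 * g + 1) * A_factor g G * card (Sp_F2 g)" if "odd g"
    using bij_betw_same_card[OF bij[OF that]]
    by (simp add: num_admissible_def card_braid_families[OF card g] card_sq_form_1_A_factor[OF card g])
  ultimately show ?thesis by blast
qed

end
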